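(* Consider the system $y_{t+1}=\theta f(y_t)+u_t+w_{t+1}$, $t\ge 0$, under the standing assumptions in the context. Let $h:[0,+\infty)\to[0,+\infty)$ be a nonnegative monotone increasing piecewise continuous function satisfying $h(x)=O(x^4)+O(1)$, and let $g(x)=|x|^{-\frac14}h^{-1}(|x|)$, where $h^{-1}$ denotes the inverse function of $h$. Let $\ell$ denote Lebesgue measure on $\mathbb{R}$ and put $S_h=\{x\in\mathbb{R}:|f(x)|<h(|x|)\}$. Suppose that $$\sum_{t=1}^{+\infty}\ \sup_{x\in[e^{2^t},+\infty)}x^{-\frac{1}{16t^2}}g(x)<+\infty$$ and that there is a $\delta>0$ such that, as $l\to+\infty$, $$\sup_{x\in\mathbb{R}}\frac{\ell(S_h\cap[x-l,x+l])}{l}=O\left(\frac{1}{(\log(\log l))^{1+\delta}}\right).$$ Then the system is unstabilizable.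
   Context: System: $y_{t+1}=\theta f(y_t)+u_t+w_{t+1}$, $t\ge0$, where $\theta\in\mathbb{R}$ is an unknown (random) parameter and $y_t,u_t,w_t\in\mathbb{R}$ are the output, input and noise. Standing assumptions: $f:\mathbb{R}\to\mathbb{R}$ is a known piecewise continuous function; the initial value $y_0$ is independent of $\theta$ and $\{w_t\}$; (A1) $\{w_t\}$ is an i.i.d. random sequence with $w_1\sim N(0,1)$; (A2) $\theta\sim N(\theta_0,P_0)$, with $P_0>0$, is independent of $\{w_t\}$. A feedback control law is a sequence $\{u_t\}_{t\ge0}$ such that $u_t$ is measurable with respect to $\mathcal{F}_t^y=\sigma\{y_i:0\le i\le t\}$ for every $t\ge0$. Definition: the system is unstabilizable if for any feedback control law $\{u_t\}$ there exists an initial $y_0$ such that, for some event $D$ with $P(D)>0$, $\limsup_{t\to+\infty}\frac1t\sum_{i=1}^t y_i^2=+\infty$ on $D$. *)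

theory Defs
  imports "HOL-Probability.Probability" "HOL-Library.Landau_Symbols"
begin

section \<open>Piecewise continuous functions\<close>

text \<open>Finitely many discontinuities in every bounded interval, each of them with finite one-sided
  limits.  At an end point of the domain the limit from the outside is a limit along the trivial
  filter, so that condition holds automatically there.\<close>

definition piecewise_continuous_on :: "real set \<Rightarrow> (real \<Rightarrow> real) \<Rightarrow> bool" where
  "piecewise_continuous_on S f \<longleftrightarrow>
     (\<forall>a b. finite {x \<in> S \<inter> {a..b}. \<not> continuous (at x within S) f}) \<and>
     (\<forall>x\<in>S. (\<exists>l. (f \<longlongrightarrow> l) (at x within S \<inter> {..<x})) \<and>
            (\<exists>l. (f \<longlongrightarrow> l) (at x within S \<inter> {x<..})))"


section \<open>The inverse of a monotone function on the half-line\<close>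

text \<open>A monotone piecewise continuous function may jump or be locally constant, so the inverse is
  taken in the generalized sense.  It is the usual inverse wherever that exists (see
  \<open>half_line_inverse_eq\<close>), and it is infinite above the range of a bounded function, which is why
  its values are in \<^typ>\<open>ennreal\<close>.\<close>

definition half_line_inverse :: "(real \<Rightarrow> real) \<Rightarrow> real \<Rightarrow> ennreal" where
  "half_line_inverse h z = (INF x\<in>{x. 0 \<le> x \<and> z \<le> h x}. ennreal x)"

lemma half_line_inverse_eq:
  assumes "strict_mono_on {0..} h" "0 \<le> x"
  shows "half_line_inverse h (h x) = ennreal x"
proof -
  have "x \<le> x'" if "0 \<le> x'" "h x \<le> h x'" for x'
    using that assms strict_mono_onD[OF assms(1), of x' x] by force
  then show ?thesis
    unfolding half_line_inverse_def using assms(2)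
    by (intro antisym INF_lower INF_greatest) (auto intro: ennreal_leI)
qed

definition growth_gap :: "(real \<Rightarrow> real) \<Rightarrow> real \<Rightarrow> ennreal" where
  "growth_gap h x = ennreal (\<bar>x\<bar> powr (- 1 / 4)) * half_line_inverse h \<bar>x\<bar>"


section \<open>Feedback control and stabilizability\<close>

text \<open>The \<open>\<sigma>\<close>-algebra on \<open>\<Omega>\<close> generated by \<open>y 0, \<dots>, y t\<close>.\<close>

definition output_algebra :: "'a set \<Rightarrow> (nat \<Rightarrow> 'a \<Rightarrow> real) \<Rightarrow> nat \<Rightarrow> 'a measure" where
  "output_algebra \<Omega> y t = sigma \<Omega> {y i -` B \<inter> \<Omega> | i B. i \<le> t \<and> B \<in> sets borel}"

text \<open>The output depends on the control and vice versa, and the definition of unstabilizability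
  chooses the initial value after the control law.  A control law is therefore given on the space of
  output sequences, with \<open>u t\<close> measurable with respect to the \<open>\<sigma>\<close>-algebra of the first \<open>t + 1\<close>
  coordinates.  Lemma \<open>measurable_output_algebra_iff\<close> shows that along any output process
  \<open>y\<close> the variables \<open>u t (y 0, y 1, \<dots>)\<close> obtained in this way are exactly the ones measurable with
  respect to \<open>output_algebra (space M) y t\<close>.\<close>

definition feedback_law :: "(nat \<Rightarrow> (nat \<Rightarrow> real) \<Rightarrow> real) \<Rightarrow> bool" where
  "feedback_law u \<longleftrightarrow> (\<forall>t. u t \<in> borel_measurable (output_algebra UNIV (\<lambda>i p. p i) t))"

lemma space_output_algebra [simp]: "space (output_algebra \<Omega> y t) = \<Omega>"
  by (simp add: output_algebra_def space_measure_of_conv)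

lemma sets_output_algebra:
  "sets (output_algebra \<Omega> y t) =
     sigma_sets \<Omega> {y i -` B \<inter> \<Omega> | i B. i \<le> t \<and> B \<in> sets borel}"
  unfolding output_algebra_def by (rule sets_measure_of) auto

lemma sets_output_algebra_vimage:
  "sets (output_algebra \<Omega> y t) =
     {(\<lambda>\<omega> i. y i \<omega>) -` A \<inter> \<Omega> | A. A \<in> sets (output_algebra UNIV (\<lambda>i p. p i) t)}"
proof -
  let ?G = "{(\<lambda>p. p i) -` B \<inter> (UNIV :: (nat \<Rightarrow> real) set) | i B. i \<le> t \<and> B \<in> sets borel}"
  have "{y i -` B \<inter> \<Omega> | i B. i \<le> t \<and> B \<in> sets borel} =
      {(\<lambda>\<omega> i. y i \<omega>) -` A \<inter> \<Omega> | A. A \<in> ?G}" (is "?L = ?R")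
  proof (intro antisym subsetI)
    fix X assume "X \<in> ?L"
    then obtain i B where "X = y i -` B \<inter> \<Omega>" "i \<le> t" "B \<in> sets borel" by blast
    then show "X \<in> ?R"
      by (intro CollectI exI[of _ "(\<lambda>p. p i) -` B \<inter> UNIV"]) auto
  next
    fix X assume "X \<in> ?R"
    then obtain i B where "X = (\<lambda>\<omega> i. y i \<omega>) -` ((\<lambda>p. p i) -` B) \<inter> \<Omega>" "i \<le> t" "B \<in> sets borel"
      by auto
    then show "X \<in> ?L" by (intro CollectI exI[of _ i] exI[of _ B]) auto
  qed
  then show ?thesis
    unfolding sets_output_algebra
    using sigma_sets_vimage_commute[of "\<lambda>\<omega> i. y i \<omega>" \<Omega> UNIV ?G] by auto
qed

lemma measurable_output_algebra_iff:
  "v \<in> borel_measurable (output_algebra \<Omega> y t) \<longleftrightarrow>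
     (\<exists>u \<in> borel_measurable (output_algebra UNIV (\<lambda>i p. p i) t).
        \<forall>\<omega>\<in>\<Omega>. v \<omega> = (u (\<lambda>i. y i \<omega>) :: real))" (is "?L \<longleftrightarrow> ?R")
proof
  let ?C = "output_algebra UNIV (\<lambda>i p. p i) t :: (nat \<Rightarrow> real) measure"
  assume ?L
  have "\<forall>q. \<exists>A\<in>sets ?C. {\<omega>\<in>\<Omega>. v \<omega> < real_of_rat q} = (\<lambda>\<omega> i. y i \<omega>) -` A \<inter> \<Omega>"
  proof
    fix q
    have "{\<omega>\<in>space (output_algebra \<Omega> y t). v \<omega> < real_of_rat q} \<in> sets (output_algebra \<Omega> y t)"
      using \<open>?L\<close> by (rule borel_measurable_less) simp
    then show "\<exists>A\<in>sets ?C. {\<omega>\<in>\<Omega>. v \<omega> < real_of_rat q} = (\<lambda>\<omega> i. y i \<omega>) -` A \<inter> \<Omega>"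
      unfolding sets_output_algebra_vimage[of \<Omega>] by auto
  qed
  then obtain A where A: "A q \<in> sets ?C"
      "{\<omega>\<in>\<Omega>. v \<omega> < real_of_rat q} = (\<lambda>\<omega> i. y i \<omega>) -` A q \<inter> \<Omega>" for q
    by metis
  define u where
    "u p = real_of_ereal (INF q. if p \<in> A q then ereal (real_of_rat q) else \<infinity>)" for p
  have "u \<in> borel_measurable ?C"
    unfolding u_def using A(1) by (intro borel_measurable_real_of_ereal borel_measurable_INF) auto
  moreover have "v \<omega> = u (\<lambda>i. y i \<omega>)" if "\<omega> \<in> \<Omega>" for \<omega>
  proof -
    have mem: "(\<lambda>i. y i \<omega>) \<in> A q \<longleftrightarrow> v \<omega> < real_of_rat q" for q
      using A(2)[of q] that by auto
    have "(INF q. if (\<lambda>i. y i \<omega>) \<in> A q then ereal (real_of_rat q) else \<infinity>) = ereal (v \<omega>)"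
      unfolding mem
    proof (rule INF_eqI)
      fix z :: ereal
      assume z: "\<And>q. q \<in> UNIV \<Longrightarrow> z \<le> (if v \<omega> < real_of_rat q then ereal (real_of_rat q) else \<infinity>)"
      show "z \<le> ereal (v \<omega>)"
      proof (rule ccontr)
        assume "\<not> z \<le> ereal (v \<omega>)"
        then obtain q where "ereal (v \<omega>) < ereal (real_of_rat q)" "ereal (real_of_rat q) < z"
          using ereal_dense3[of "ereal (v \<omega>)" z] by (meson not_le)
        then show False using z[of q] by auto
      qed
    qed (auto simp: less_imp_le)
    then show ?thesis by (simp add: u_def)
  qed
  ultimately show ?R by blast
next
  assume ?R
  then obtain u where u: "u \<in> borel_measurable (output_algebra UNIV (\<lambda>i p. p i) t)"
      "\<And>\<omega>. \<omega> \<in> \<Omega> \<Longrightarrow> v \<omega> = (u (\<lambda>i. y i \<omega>) :: real)"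
    by blast
  have "(\<lambda>\<omega> i. y i \<omega>) \<in> output_algebra \<Omega> y t \<rightarrow>\<^sub>M output_algebra UNIV (\<lambda>i p. p i) t"
    by (rule measurableI) (auto simp: sets_output_algebra_vimage[of \<Omega>])
  from measurable_compose[OF this u(1)] show ?L
    by (rule measurable_cong[THEN iffD1, rotated]) (simp add: u(2))
qed

text \<open>The library's \<open>indep_var\<close> requires both variables to take values in the same type, which is
  too narrow for a real variable and a noise sequence.\<close>

definition indep_variables ::
  "'a measure \<Rightarrow> 'b measure \<Rightarrow> ('a \<Rightarrow> 'b) \<Rightarrow> 'c measure \<Rightarrow> ('a \<Rightarrow> 'c) \<Rightarrow> bool" where
  "indep_variables M S X T Y \<longleftrightarrow> X \<in> M \<rightarrow>\<^sub>M S \<and> Y \<in> M \<rightarrow>\<^sub>M T \<and>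
     prob_space.indep_set M (sets (vimage_algebra (space M) X S))
                            (sets (vimage_algebra (space M) Y T))"

lemma (in prob_space) indep_variables_eq_indep_var:
  "indep_variables M S X T Y \<longleftrightarrow> indep_var S X T Y"
  unfolding indep_variables_def indep_var_eq sets_vimage_algebra by blast

text \<open>The noise is \<open>w 1, w 2, \<dots>\<close>; the value \<open>w 0\<close> plays no role.\<close>

abbreviation noise :: "(nat \<Rightarrow> 'a \<Rightarrow> real) \<Rightarrow> 'a \<Rightarrow> nat \<Rightarrow> real" where
  "noise w \<omega> \<equiv> (\<lambda>t\<in>{1..}. w t \<omega>)"

abbreviation noise_space :: "(nat \<Rightarrow> real) measure" where
  "noise_space \<equiv> Pi\<^sub>M {1..} (\<lambda>_. borel)"

definition initial_value :: "'a measure \<Rightarrow> ('a \<Rightarrow> real) \<Rightarrow> (nat \<Rightarrow> 'a \<Rightarrow> real) \<Rightarrow> ('a \<Rightarrow> real) \<Rightarrow> bool" where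
  "initial_value M \<theta> w y0 \<longleftrightarrow>
     indep_variables M borel y0 (borel \<Otimes>\<^sub>M noise_space) (\<lambda>\<omega>. (\<theta> \<omega>, noise w \<omega>))"

definition closed_loop ::
  "'a measure \<Rightarrow> (real \<Rightarrow> real) \<Rightarrow> ('a \<Rightarrow> real) \<Rightarrow> (nat \<Rightarrow> 'a \<Rightarrow> real) \<Rightarrow>
     (nat \<Rightarrow> (nat \<Rightarrow> real) \<Rightarrow> real) \<Rightarrow> (nat \<Rightarrow> 'a \<Rightarrow> real) \<Rightarrow> bool" where
  "closed_loop M f \<theta> w u y \<longleftrightarrow>
     (\<forall>t. \<forall>\<omega>\<in>space M. y (Suc t) \<omega> = \<theta> \<omega> * f (y t \<omega>) + u t (\<lambda>i. y i \<omega>) + w (Suc t) \<omega>)"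

text \<open>For a feedback law \<open>u\<close> the output \<open>y\<close> of the closed loop is determined by \<open>y 0\<close>, so the
  existential quantifier over \<open>y\<close> is one over the initial value.\<close>

definition unstabilizable ::
  "'a measure \<Rightarrow> (real \<Rightarrow> real) \<Rightarrow> ('a \<Rightarrow> real) \<Rightarrow> (nat \<Rightarrow> 'a \<Rightarrow> real) \<Rightarrow> bool" where
  "unstabilizable M f \<theta> w \<longleftrightarrow>
     (\<forall>u. feedback_law u \<longrightarrow>
       (\<exists>y. initial_value M \<theta> w (y 0) \<and> closed_loop M f \<theta> w u y \<and>
         (\<exists>D\<in>sets M. measure M D > 0 \<and>
           (\<forall>\<omega>\<in>D. limsup (\<lambda>t. ereal (1 / real t * (\<Sum>i=1..t. (y i \<omega>)\<^sup>2))) = \<infinity>))))"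

end

theory Submission
  imports Defs
begin

text \<open>Given the outputs up to time \<open>t\<close>, the parameter is Gaussian with precision
  \<open>r\<^sub>t = 1 / P\<^sub>0 + (\<Sum>i<t. f (y\<^sub>i)\<^sup>2)\<close>, so \<open>y\<^sub>t\<^sub>+\<^sub>1\<close> is Gaussian with variance \<open>r\<^sub>t\<^sub>+\<^sub>1 / r\<^sub>t\<close>; the control only
  shifts its mean.  With large conditional probability \<open>y\<^sub>t\<^sub>+\<^sub>1\<close> therefore avoids the thin set \<open>S\<^sub>h\<close> and
  is not much smaller than its standard deviation, and then \<open>f (y\<^sub>t\<^sub>+\<^sub>1)\<close> is at least \<open>h\<close> of that size.
  For \<open>a\<^sub>t = ln r\<^sub>t\<close> this gives \<open>a\<^sub>t\<^sub>+\<^sub>2 \<ge> 4 q\<^sub>t (a\<^sub>t\<^sub>+\<^sub>1 - a\<^sub>t)\<close> with \<open>q\<^sub>t = 4 s\<^sup>2 / (4 s\<^sup>2 + 1)\<close>, where \<open>s\<close> is \<open>t\<close> plus a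
  constant.  In terms of \<open>x\<^sub>t = a\<^sub>t / 2\<^sup>t\<close> it is a discrete form of the Euler equation
  \<open>x'' = - x / (4 t\<^sup>2)\<close>, whose constant is the largest one that admits a positive solution, namely \<open>\<surd>t\<close>;
  hence \<open>a\<^sub>t\<close> grows at least like \<open>2\<^sup>t\<close>.  The failure probabilities are summable in \<open>t\<close>, and starting
  from a large deterministic \<open>y\<^sub>0\<close> their sum is less than one.\<close>

section \<open>Gaussian densities\<close>

text \<open>Bayes' rule for a Gaussian prior of precision \<open>r\<close> and an observation
  \<open>v\<close> of \<open>x * f + m\<close> under unit noise: prior times likelihood is
  prediction times posterior.\<close>

lemma normal_density_mult_eq:
  fixes r f \<mu> m x v :: real
  assumes "r > 0"
  shows "normal_density \<mu> (1 / sqrt r) x * normal_density (x * f + m) 1 v =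
    normal_density (\<mu> * f + m) (sqrt ((r + f\<^sup>2) / r)) v *
    normal_density ((r * \<mu> + f * (v - m)) / (r + f\<^sup>2)) (1 / sqrt (r + f\<^sup>2)) x"
proof -
  define R where "R = r + f\<^sup>2"
  have R: "R > 0" unfolding R_def using assms by (simp add: add_pos_nonneg)
  have "sqrt (2 * pi * (1 / sqrt r)\<^sup>2) * sqrt (2 * pi * 1\<^sup>2) =
      sqrt (2 * pi * (sqrt (R / r))\<^sup>2) * sqrt (2 * pi * (1 / sqrt R)\<^sup>2)"
    using assms R by (simp add: real_sqrt_mult[symmetric] power_divide)
  moreover have "- (x - \<mu>)\<^sup>2 / (2 * (1 / sqrt r)\<^sup>2) + - (v - (x * f + m))\<^sup>2 / (2 * 1\<^sup>2) =
     - (v - (\<mu> * f + m))\<^sup>2 / (2 * (sqrt (R / r))\<^sup>2) +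
     - (x - (r * \<mu> + f * (v - m)) / R)\<^sup>2 / (2 * (1 / sqrt R)\<^sup>2)"
  proof -
    \<comment> \<open>Completing the square in \<open>x\<close>, multiplied by \<open>R\<close> so
      that the identity is polynomial.\<close>
    have "R * (r * (x - \<mu>)\<^sup>2 + (v - (x * f + m))\<^sup>2) =
       r * (v - (\<mu> * f + m))\<^sup>2 + (R * x - (r * \<mu> + f * (v - m)))\<^sup>2"
      unfolding R_def by algebra
    then have "r * (x - \<mu>)\<^sup>2 + (v - (x * f + m))\<^sup>2 =
       (r * (v - (\<mu> * f + m))\<^sup>2 + (R * x - (r * \<mu> + f * (v - m)))\<^sup>2) / R"
      using R by (simp add: nonzero_eq_divide_eq mult.commute)
    moreover have "x - (r * \<mu> + f * (v - m)) / R = (R * x - (r * \<mu> + f * (v - m))) / R"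
      using R by (simp add: diff_divide_distrib)
    then have "R * (x - (r * \<mu> + f * (v - m)) / R)\<^sup>2 = (R * x - (r * \<mu> + f * (v - m)))\<^sup>2 / R"
      using R by (simp add: power_divide power2_eq_square)
    ultimately have "r * (x - \<mu>)\<^sup>2 + (v - (x * f + m))\<^sup>2 =
       r * (v - (\<mu> * f + m))\<^sup>2 / R + R * (x - (r * \<mu> + f * (v - m)) / R)\<^sup>2"
      by (simp add: add_divide_distrib)
    moreover have "- (x - \<mu>)\<^sup>2 / (2 * (1 / sqrt r)\<^sup>2) + - (v - (x * f + m))\<^sup>2 / (2 * 1\<^sup>2) =
        - (r * (x - \<mu>)\<^sup>2 + (v - (x * f + m))\<^sup>2) / 2"
      using assms by (simp add: power_divide add_divide_distrib diff_divide_distrib)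
    moreover have "- (v - (\<mu> * f + m))\<^sup>2 / (2 * (sqrt (R / r))\<^sup>2) +
       - (x - (r * \<mu> + f * (v - m)) / R)\<^sup>2 / (2 * (1 / sqrt R)\<^sup>2) =
       - (r * (v - (\<mu> * f + m))\<^sup>2 / R + R * (x - (r * \<mu> + f * (v - m)) / R)\<^sup>2) / 2"
      using assms R by (simp add: power_divide add_divide_distrib diff_divide_distrib mult_ac)
    ultimately show ?thesis by (simp only:)
  qed
  moreover have "1 / a * exp x * (1 / b * exp y) = exp (x + y) / (a * b)" for a b x y :: real
    by (simp add: exp_add)
  ultimately show ?thesis
    unfolding R_def[symmetric] normal_density_def by (simp only:)
qed

lemma normal_density_le:
  assumes "\<sigma> > 0"
  shows "normal_density m \<sigma> v \<le> 1 / (2 * \<sigma>)"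
proof -
  have "2 * \<sigma> = sqrt (4 * \<sigma>\<^sup>2)"
    using assms by (simp add: real_sqrt_mult)
  also have "\<dots> \<le> sqrt (2 * pi * \<sigma>\<^sup>2)"
    using pi_ge_two by (intro real_sqrt_le_mono mult_right_mono) auto
  finally have "1 / sqrt (2 * pi * \<sigma>\<^sup>2) \<le> 1 / (2 * \<sigma>)"
    using assms by (intro divide_left_mono) auto
  moreover have "normal_density m \<sigma> v \<le> 1 / sqrt (2 * pi * \<sigma>\<^sup>2) * 1"
    unfolding normal_density_def by (intro mult_left_mono) auto
  ultimately show ?thesis by simp
qed

text \<open>Dominating the density by a mixture of uniform kernels reduces integrals over a set to the
  measures of its parts in intervals.\<close>

lemma normal_density_le_series:
  fixes m v \<sigma> :: real
  assumes \<sigma>: "\<sigma> > 0"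
  shows "ennreal (normal_density m \<sigma> v) \<le>
    (\<Sum>k. ennreal ((1 / 2) ^ k / \<sigma>) * indicator {m - (real k + 1) * \<sigma>..m + (real k + 1) * \<sigma>} v)"
proof -
  define k where "k = nat \<lfloor>\<bar>v - m\<bar> / \<sigma>\<rfloor>"
  have k: "real k \<le> \<bar>v - m\<bar> / \<sigma>" "\<bar>v - m\<bar> / \<sigma> < real k + 1"
    unfolding k_def using \<sigma> by (auto simp: of_nat_nat)
  then have "v \<in> {m - (real k + 1) * \<sigma>..m + (real k + 1) * \<sigma>}"
    using \<sigma> by (auto simp: field_simps abs_if split: if_splits)
  \<comment> \<open>A linear minorant of the square turns the Gaussian decay into a geometric one,
    of rate \<open>exp (-1) \<le> 1 / 2\<close>.\<close>
  have "real k - 1 / 2 \<le> (real k)\<^sup>2 / 2"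
    using zero_le_power2[of "real k - 1"] by (simp add: power2_eq_square algebra_simps)
  also have "\<dots> \<le> (\<bar>v - m\<bar> / \<sigma>)\<^sup>2 / 2"
    using k by (intro divide_right_mono power_mono) auto
  finally have "exp (- (v - m)\<^sup>2 / (2 * \<sigma>\<^sup>2)) \<le> exp (1 / 2 - real k)"
    by (simp add: power_divide field_simps)
  also have "\<dots> = exp (1 / 2) * exp (-1) ^ k"
    by (simp add: exp_of_nat_mult[symmetric] exp_add[symmetric])
  also have "\<dots> \<le> 2 * (1 / 2) ^ k"
  proof (intro mult_mono power_mono)
    have "exp (1 / 2 :: real) \<le> exp 1 powr (1/2)" by (simp add: powr_def)
    also have "\<dots> \<le> 4 powr (1/2)" using exp_le by (intro powr_mono2) auto
    also have "\<dots> = (2::real)" by (simp add: powr_half_sqrt)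
    finally show "exp (1 / 2 :: real) \<le> 2" .
    have "2 \<le> exp (1::real)" using exp_ge_add_one_self[of "1::real"] by simp
    then show "exp (-1 :: real) \<le> 1 / 2" by (simp add: exp_minus field_simps)
  qed auto
  finally have e: "exp (- (v - m)\<^sup>2 / (2 * \<sigma>\<^sup>2)) \<le> 2 * (1 / 2) ^ k" .
  have "1 / sqrt (2 * pi * \<sigma>\<^sup>2) \<le> 1 / (2 * \<sigma>)"
    using normal_density_le[OF \<sigma>, of m m] by (simp add: normal_density_def)
  then have "normal_density m \<sigma> v \<le> 1 / (2 * \<sigma>) * (2 * (1 / 2) ^ k)"
    unfolding normal_density_def using e \<sigma> by (intro mult_mono) auto
  then have "ennreal (normal_density m \<sigma> v) \<le> ennreal ((1 / 2) ^ k / \<sigma>)"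
    by (intro ennreal_leI) (simp add: field_simps)
  \<comment> \<open>The single term of index \<open>k\<close> already dominates the density at
    \<open>v\<close>.\<close>
  also have "\<dots> = (\<Sum>j\<in>{k}. ennreal ((1 / 2) ^ j / \<sigma>) *
      indicator {m - (real j + 1) * \<sigma>..m + (real j + 1) * \<sigma>} v)"
    using \<open>v \<in> _\<close> by simp
  also have "\<dots> \<le> (\<Sum>j. ennreal ((1 / 2) ^ j / \<sigma>) *
      indicator {m - (real j + 1) * \<sigma>..m + (real j + 1) * \<sigma>} v)"
    by (intro sum_le_suminf) auto
  finally show ?thesis .
qed

text \<open>The kernel of index \<open>k\<close> has half-width \<open>(k + 1) * \<sigma>\<close>,
  so only windows with \<open>l \<ge> \<sigma>\<close> are tested and asymptotic thinness suffices
  once \<open>\<sigma>\<close> is large. The constant 4 is the sum of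
  \<open>(k + 1) / 2 ^ k\<close>.\<close>

lemma nn_integral_normal_density_le:
  fixes m \<sigma> \<kappa> :: real
  assumes \<sigma>: "\<sigma> > 0" and S[measurable]: "S \<in> sets borel" and \<kappa>: "\<kappa> \<ge> 0"
    and bnd: "\<And>l. l \<ge> \<sigma> \<Longrightarrow> measure lborel (S \<inter> {m - l..m + l}) \<le> \<kappa> * l"
  shows "(\<integral>\<^sup>+v. ennreal (normal_density m \<sigma> v) * indicator S v \<partial>lborel) \<le> ennreal (4 * \<kappa>)"
proof -
  let ?J = "\<lambda>k::nat. {m - (real k + 1) * \<sigma>..m + (real k + 1) * \<sigma>}"
  have "(\<integral>\<^sup>+v. ennreal (normal_density m \<sigma> v) * indicator S v \<partial>lborel) \<le>
    (\<integral>\<^sup>+v. (\<Sum>k. ennreal ((1 / 2) ^ k / \<sigma>) * indicator (S \<inter> ?J k) v) \<partial>lborel)"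
  proof (rule nn_integral_mono)
    fix v
    show "ennreal (normal_density m \<sigma> v) * indicator S v \<le>
        (\<Sum>k. ennreal ((1 / 2) ^ k / \<sigma>) * indicator (S \<inter> ?J k) v)"
      using normal_density_le_series[OF \<sigma>, of m v]
      by (cases "v \<in> S") (auto simp: indicator_inter_arith)
  qed
  also have "\<dots> = (\<Sum>k. ennreal ((1 / 2) ^ k / \<sigma>) * emeasure lborel (S \<inter> ?J k))"
    by (subst nn_integral_suminf) (auto simp: nn_integral_cmult)
  also have "\<dots> \<le> (\<Sum>k. ennreal (\<kappa> * (real (Suc k) * (1 / 2) ^ k)))"
  proof (intro suminf_le)
    fix k
    \<comment> \<open>The window has finite length, so \<open>measure\<close> is the true length
      here and not its default value 0.\<close>
    have "emeasure lborel (S \<inter> ?J k) \<le> emeasure lborel (?J k)"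
      by (intro emeasure_mono) auto
    also have "\<dots> < \<infinity>" by (simp add: emeasure_lborel_Icc_eq)
    finally have "emeasure lborel (S \<inter> ?J k) = ennreal (measure lborel (S \<inter> ?J k))"
      by (intro emeasure_eq_ennreal_measure) auto
    also have "\<dots> \<le> ennreal (\<kappa> * ((real k + 1) * \<sigma>))"
      using \<sigma> by (intro ennreal_leI bnd) (auto simp: algebra_simps)
    finally have "ennreal ((1 / 2) ^ k / \<sigma>) * emeasure lborel (S \<inter> ?J k) \<le>
        ennreal ((1 / 2) ^ k / \<sigma>) * ennreal (\<kappa> * ((real k + 1) * \<sigma>))"
      by (intro mult_left_mono) auto
    also have "\<dots> = ennreal (\<kappa> * (real (Suc k) * (1 / 2) ^ k))"
      using \<sigma> \<kappa> by (subst ennreal_mult[symmetric]) (auto simp: field_simps)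
    finally show "ennreal ((1 / 2) ^ k / \<sigma>) * emeasure lborel (S \<inter> ?J k) \<le>
        ennreal (\<kappa> * (real (Suc k) * (1 / 2) ^ k))" .
  qed auto
  also have "\<dots> = ennreal (4 * \<kappa>)"
  proof -
    have "(\<lambda>k. real (Suc k) * (1 / 2) ^ k) sums 4"
      using geometric_deriv_sums[of "1 / 2 :: real"] by (simp add: power_divide)
    then have "(\<lambda>k. \<kappa> * (real (Suc k) * (1 / 2) ^ k)) sums (\<kappa> * 4)"
      by (rule sums_mult)
    then show ?thesis using \<kappa>
      by (subst suminf_ennreal2) (auto simp: sums_iff mult.commute)
  qed
  finally show ?thesis .
qed

text \<open>A density of at most \<open>1 / (2 * \<sigma>)\<close> meets an interval of length
  \<open>2 * \<epsilon> * \<sigma>\<close>. The bound is uniform in the mean, hence in the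
  control.\<close>

lemma nn_integral_normal_density_near_zero_le:
  fixes m \<sigma> \<epsilon> :: real
  assumes \<sigma>: "\<sigma> > 0" and "\<epsilon> \<ge> 0"
  shows "(\<integral>\<^sup>+v. ennreal (normal_density m \<sigma> v) * indicator {v. \<bar>v\<bar> < \<epsilon> * \<sigma>} v \<partial>lborel) \<le> ennreal \<epsilon>"
proof -
  have "(\<integral>\<^sup>+v. ennreal (normal_density m \<sigma> v) * indicator {v. \<bar>v\<bar> < \<epsilon> * \<sigma>} v \<partial>lborel) \<le>
     (\<integral>\<^sup>+v. ennreal (1 / (2 * \<sigma>)) * indicator {-(\<epsilon> * \<sigma>)..\<epsilon> * \<sigma>} v \<partial>lborel)"
    using normal_density_le[OF \<sigma>, of m]
    by (intro nn_integral_mono mult_mono) (auto intro!: ennreal_leI simp: indicator_def)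
  also have "\<dots> = ennreal (1 / (2 * \<sigma>)) * ennreal (2 * (\<epsilon> * \<sigma>))"
    using assms by (subst nn_integral_cmult_indicator) (auto simp: emeasure_lborel_Icc_eq)
  also have "\<dots> = ennreal \<epsilon>"
    using assms by (subst ennreal_mult[symmetric]) auto
  finally show ?thesis .
qed

lemma measurable_normal_density [measurable]:
  assumes [measurable]: "g \<in> borel_measurable N" "s \<in> borel_measurable N" "k \<in> borel_measurable N"
  shows "(\<lambda>x. normal_density (g x) (s x) (k x)) \<in> borel_measurable N"
  unfolding normal_density_def by measurable

lemma nn_integral_normal_density_eq_1:
  "\<sigma> > 0 \<Longrightarrow> (\<integral>\<^sup>+x. ennreal (normal_density m \<sigma> x) \<partial>lborel) = 1"
  using prob_space.emeasure_space_1[OF prob_space_normal_density[of \<sigma> m]]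
  by (simp add: emeasure_density)

section \<open>Growth, thin sets and summability\<close>

text \<open>The infimum defining the inverse need not be attained; the strict inequality supplies a
  smaller point that already reaches \<open>z\<close>.\<close>

lemma half_line_inverse_less_imp_le:
  assumes "mono_on {0..} h" "half_line_inverse h z < ennreal x"
  shows "z \<le> h x"
proof -
  obtain x' where x': "0 \<le> x'" "z \<le> h x'" "ennreal x' < ennreal x"
    using assms(2) unfolding half_line_inverse_def INF_less_iff by auto
  then have "x' < x" by (simp add: ennreal_less_iff)
  then show ?thesis
    using x' mono_onD[OF assms(1), of x' x] by auto
qed

text \<open>The exponents 1/4 and 1/(16 s^2) add up to (4 s^2 + 1)/(16 s^2), and \<open>z\<close> is
  chosen so that this power of \<open>z\<close> is \<open>exp (d / 2)\<close>. The gap bound thus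
  places the inverse of \<open>h\<close> at \<open>z\<close> below \<open>g * exp (d / 2)\<close>.
  In the application \<open>d\<close> is the increment of the log precision and
  \<open>exp (d / 2)\<close> the predictive standard deviation.\<close>

lemma le_of_growth_gap_le:
  fixes g d s :: real
  assumes h: "mono_on {0..} h" and s: "s > 0" and "g \<ge> 0"
    and z: "z = exp (8 * s\<^sup>2 / (4 * s\<^sup>2 + 1) * d)"
    and gap: "ennreal (z powr (- 1 / (16 * s\<^sup>2))) * growth_gap h z \<le> ennreal g"
    and x: "g * exp (d / 2) < x"
  shows "z \<le> h x"
proof (rule half_line_inverse_less_imp_le[OF h])
  have "z > 0" using z by simp
  define E where "E = z powr (1 / (16 * s\<^sup>2)) * z powr (1 / 4)"
  have "exp L powr a * exp L powr b = exp ((a + b) * L)" for L a b :: real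
    by (simp add: powr_def exp_add[symmetric] distrib_right)
  then have "E = exp ((1 / (16 * s\<^sup>2) + 1 / 4) * (8 * s\<^sup>2 / (4 * s\<^sup>2 + 1) * d))"
    unfolding E_def z .
  also have "(1 / (16 * s\<^sup>2) + 1 / 4) * (8 * s\<^sup>2 / (4 * s\<^sup>2 + 1) * d) = d / 2"
  proof -
    have "4 * s\<^sup>2 + 1 > 0" "s\<^sup>2 > 0" using s by (auto intro: add_nonneg_pos)
    moreover have "1 / (16 * s\<^sup>2) + 1 / 4 = (4 * s\<^sup>2 + 1) / (16 * s\<^sup>2)"
      using s by (simp add: field_simps)
    moreover have "A / (16 * b) * (8 * b / A * d) = d / 2" if "A > 0" "b > 0" for A b :: real
      using that by simp
    ultimately show ?thesis by (simp only:)
  qed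
  finally have E: "E = exp (d / 2)" .
  have "E * (z powr (- 1 / (16 * s\<^sup>2)) * z powr (- 1 / 4)) = 1"
    unfolding E_def using \<open>z > 0\<close> by (simp add: powr_minus field_simps)
  then have "half_line_inverse h z =
      ennreal (E * (z powr (- 1 / (16 * s\<^sup>2)) * z powr (- 1 / 4))) * half_line_inverse h z"
    by simp
  also have "\<dots> = ennreal E * (ennreal (z powr (- 1 / (16 * s\<^sup>2))) * growth_gap h z)"
    unfolding growth_gap_def using \<open>z > 0\<close> E by (simp add: ennreal_mult mult.assoc)
  also have "\<dots> \<le> ennreal E * ennreal g"
    by (rule mult_left_mono[OF gap]) simp
  also have "\<dots> = ennreal (g * exp (d / 2))"
    using \<open>g \<ge> 0\<close> E by (simp add: ennreal_mult[symmetric] mult.commute)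
  also have "\<dots> < ennreal x"
    using x \<open>g \<ge> 0\<close> by (simp add: ennreal_less_iff)
  finally show "half_line_inverse h z < ennreal x" .
qed

text \<open>The ratio \<open>a\<^sub>1 / a\<^sub>0 \<ge> 2 (1 + 1 / (2 \<tau>))\<close> is the discrete trace of the solution \<open>\<surd>t\<close> of the Euler equation.
  It is stated without division because \<open>a\<^sub>0\<close> may be negative.\<close>

lemma discrete_euler_step:
  fixes a\<^sub>0 a\<^sub>1 a\<^sub>2 \<tau> :: real
  assumes \<tau>: "\<tau> > 0" and "a\<^sub>1 \<ge> 0" and ratio: "(2 * \<tau> + 1) * a\<^sub>0 \<le> \<tau> * a\<^sub>1"
    and step: "a\<^sub>2 \<ge> 16 * (\<tau> + 1)\<^sup>2 / (4 * (\<tau> + 1)\<^sup>2 + 1) * (a\<^sub>1 - a\<^sub>0)"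
  shows "(2 * (\<tau> + 1) + 1) * a\<^sub>1 \<le> (\<tau> + 1) * a\<^sub>2"
proof -
  define s where "s = \<tau> + 1"
  have s: "s > 1" using \<tau> by (simp add: s_def)
  then have pos: "4 * s\<^sup>2 + 1 > 0" "2 * s - 1 > 0" by (auto intro: add_nonneg_pos)
  \<comment> \<open>In terms of \<open>s\<close> the ratio reads
    \<open>(2 * s - 1) * a\<^sub>0 \<le> (s - 1) * a\<^sub>1\<close>.\<close>
  have "(2 * s - 1) * (a\<^sub>1 - a\<^sub>0) \<ge> s * a\<^sub>1"
    using ratio by (simp add: s_def algebra_simps)
  then have "a\<^sub>1 - a\<^sub>0 \<ge> s * a\<^sub>1 / (2 * s - 1)"
    using pos by (simp add: pos_divide_le_eq mult.commute)
  then have "16 * s\<^sup>2 / (4 * s\<^sup>2 + 1) * (s * a\<^sub>1 / (2 * s - 1)) \<le> a\<^sub>2"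
    using step pos unfolding s_def[symmetric]
    by (elim order_trans[rotated]) (intro mult_left_mono, auto)
  then have "s * (16 * s\<^sup>2 / (4 * s\<^sup>2 + 1) * (s * a\<^sub>1 / (2 * s - 1))) \<le> s * a\<^sub>2"
    using s by (intro mult_left_mono) auto
  moreover have "(2 * s + 1) * a\<^sub>1 \<le> s * (16 * s\<^sup>2 / (4 * s\<^sup>2 + 1) * (s * a\<^sub>1 / (2 * s - 1)))"
  proof -
    \<comment> \<open>The left side is 16 s^4 - 1, so the ratio reproduces itself with almost
      nothing to spare.\<close>
    have "(2 * s + 1) * ((4 * s\<^sup>2 + 1) * (2 * s - 1)) \<le> 16 * s\<^sup>2 * s\<^sup>2"
      by (simp add: algebra_simps power2_eq_square)
    then have "(2 * s + 1) \<le> 16 * s\<^sup>2 * s\<^sup>2 / ((4 * s\<^sup>2 + 1) * (2 * s - 1))"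
      using pos by (simp add: pos_le_divide_eq)
    then have "(2 * s + 1) * a\<^sub>1 \<le> 16 * s\<^sup>2 * s\<^sup>2 / ((4 * s\<^sup>2 + 1) * (2 * s - 1)) * a\<^sub>1"
      using \<open>a\<^sub>1 \<ge> 0\<close> by (intro mult_right_mono) auto
    also have "\<dots> = s * (16 * s\<^sup>2 / (4 * s\<^sup>2 + 1) * (s * a\<^sub>1 / (2 * s - 1)))"
      by (simp add: power2_eq_square mult_ac)
    finally show ?thesis .
  qed
  ultimately show ?thesis by (simp add: s_def)
qed

section \<open>Measurability, and explicit forms of the summability and thinness hypotheses\<close>

lemma piecewise_continuous_measurable:
  assumes "piecewise_continuous_on UNIV f"
  shows "f \<in> borel_measurable borel"
proof (rule borel_measurable_continuous_countable_exceptions)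
  let ?X = "{x. \<not> isCont f x}"
  have "finite {x \<in> UNIV \<inter> {- real n..real n}. \<not> isCont f x}" for n
    using assms unfolding piecewise_continuous_on_def by blast
  then have "countable (\<Union>n. {x \<in> UNIV \<inter> {- real n..real n}. \<not> isCont f x})"
    by (intro countable_UN) (auto intro: countable_finite)
  moreover have "?X \<subseteq> (\<Union>n. {x \<in> UNIV \<inter> {- real n..real n}. \<not> isCont f x})"
  proof
    fix x assume "x \<in> ?X"
    moreover obtain n where "\<bar>x\<bar> \<le> real n" using real_arch_simple by blast
    ultimately show "x \<in> (\<Union>n. {x \<in> UNIV \<inter> {- real n..real n}. \<not> isCont f x})"
      by (auto intro!: exI[of _ n])
  qed
  ultimately show "countable ?X" by (rule countable_subset[rotated])
  show "continuous_on (- ?X) f"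
    by (auto intro!: continuous_at_imp_continuous_on)
qed

text \<open>Values of \<open>h\<close> at negative arguments are arbitrary, hence the composition
  with the absolute value.\<close>

lemma mono_on_half_line_measurable:
  fixes h :: "real \<Rightarrow> real"
  assumes "mono_on {0..} h"
  shows "(\<lambda>x. h \<bar>x\<bar>) \<in> borel_measurable borel"
proof -
  have "abs \<in> borel \<rightarrow>\<^sub>M restrict_space borel {0::real..}"
    by (intro measurable_restrict_space2) auto
  from measurable_compose[OF this borel_measurable_mono_on_fnc[OF assms]] show ?thesis .
qed

text \<open>Each term is bounded by the total and so is finite, which keeps \<open>enn2real\<close>
  from replacing infinity by 0. The shift to \<open>Suc t\<close> reflects that the sum starts at
  1.\<close>

lemma summable_enn2real:
  fixes g :: "nat \<Rightarrow> ennreal"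
  assumes "infsum g {1..} < \<infinity>"
  shows "t \<ge> 1 \<Longrightarrow> g t = ennreal (enn2real (g t))" and "summable (\<lambda>t. enn2real (g (Suc t)))"
proof -
  have le: "sum g F \<le> infsum g {1..}" if "finite F" "F \<subseteq> {1..}" for F
    by (subst nonneg_infsum_complete) (use that in \<open>auto intro!: SUP_upper\<close>)
  have fin: "g t < \<infinity>" if "t \<ge> 1" for t
    using le[of "{t}"] that assms by (simp add: order_le_less_trans)
  then show "t \<ge> 1 \<Longrightarrow> g t = ennreal (enn2real (g t))" by simp
  show "summable (\<lambda>t. enn2real (g (Suc t)))"
  proof (rule summableI_nonneg_bounded)
    fix n
    have "ennreal (\<Sum>t<n. enn2real (g (Suc t))) = (\<Sum>t<n. g (Suc t))"
      using fin by (subst sum_ennreal[symmetric]) (auto intro!: sum.cong)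
    also have "\<dots> = sum g (Suc ` {..<n})"
      by (simp add: sum.reindex)
    also have "\<dots> \<le> infsum g {1..}" by (rule le) auto
    also have "\<dots> = ennreal (enn2real (infsum g {1..}))" using assms by simp
    finally show "(\<Sum>t<n. enn2real (g (Suc t))) \<le> enn2real (infsum g {1..})"
      by (simp add: ennreal_le_iff)
  qed simp
qed

lemma thin_set_bound:
  fixes S :: "real set"
  assumes S: "S \<in> sets borel"
    and thin: "(\<lambda>l::real. SUP x::real. measure lebesgue (S \<inter> {x - l..x + l}) / l)
           \<in> O[at_top](\<lambda>l. 1 / ln (ln l) powr (1 + \<delta>))"
  obtains K l\<^sub>0 where "K > 0"
    "\<And>l x. l \<ge> l\<^sub>0 \<Longrightarrow> l > 0 \<Longrightarrow> measure lborel (S \<inter> {x - l..x + l}) \<le> K / ln (ln l) powr (1 + \<delta>) * l"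
proof -
  obtain K where K: "K > 0" and ev: "eventually (\<lambda>l. norm (SUP x::real. measure lebesgue (S \<inter> {x - l..x + l}) / l)
      \<le> K * norm (1 / ln (ln l) powr (1 + \<delta>))) at_top"
    using thin by (rule landau_o.bigE)
  obtain l\<^sub>0 where l0: "\<And>l. l \<ge> l\<^sub>0 \<Longrightarrow> norm (SUP x::real. measure lebesgue (S \<inter> {x - l..x + l}) / l)
      \<le> K * norm (1 / ln (ln l) powr (1 + \<delta>))"
    using ev unfolding eventually_at_top_linorder by blast
  show thesis
  proof (rule that[OF K])
    fix l x :: real assume l: "l \<ge> l\<^sub>0" "l > 0"
    \<comment> \<open>A real supremum dominates its members only for a family bounded above; here
      the window length gives the bound 2.\<close>
    have "measure lebesgue (S \<inter> {z - l..z + l}) / l \<le> 2" for z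
    proof -
      have "measure lebesgue (S \<inter> {z - l..z + l}) = measure lborel (S \<inter> {z - l..z + l})"
        using S by (subst measure_completion) auto
      also have "\<dots> \<le> measure lborel {z - l..z + l}"
        by (rule measure_mono_fmeasurable) (use S in \<open>auto simp: fmeasurable_def emeasure_lborel_Icc_eq\<close>)
      also have "\<dots> = 2 * l" using l by simp
      finally show ?thesis using l by (simp add: field_simps)
    qed
    then have "bdd_above (range (\<lambda>z. measure lebesgue (S \<inter> {z - l..z + l}) / l))"
      by (intro bdd_aboveI[of _ 2]) auto
    then have "measure lebesgue (S \<inter> {x - l..x + l}) / l \<le> (SUP x::real. measure lebesgue (S \<inter> {x - l..x + l}) / l)"
      by (rule cSUP_upper[rotated]) simp
    also have "\<dots> \<le> K / ln (ln l) powr (1 + \<delta>)"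
      using l0[OF l(1)] by simp
    finally have "measure lebesgue (S \<inter> {x - l..x + l}) \<le> K / ln (ln l) powr (1 + \<delta>) * l"
      using l by (simp add: pos_divide_le_eq)
    then show "measure lborel (S \<inter> {x - l..x + l}) \<le> K / ln (ln l) powr (1 + \<delta>) * l"
      using S by (subst (asm) measure_completion) auto
  qed
qed

text \<open>Otherwise \<open>S\<close> contains a half-line, where windows have relative measure 2,
  while the assumed bound tends to 0.\<close>

lemma exists_point_outside_thin_set:
  fixes S :: "real set"
  assumes \<delta>: "\<delta> > 0" and S: "S \<in> sets borel"
    and thin: "\<And>l x. l \<ge> l\<^sub>0 \<Longrightarrow> l > 0 \<Longrightarrow> measure lborel (S \<inter> {x - l..x + l}) \<le> K / ln (ln l) powr (1 + \<delta>) * l"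
  shows "\<exists>c\<ge>b. c \<notin> S"
proof (rule ccontr)
  assume "\<not> ?thesis"
  then have sub: "{b..} \<subseteq> S" by auto
  have "((\<lambda>l. K / ln (ln l) powr (1 + \<delta>)) \<longlongrightarrow> 0) at_top"
    using \<delta> by real_asymp
  then have "eventually (\<lambda>l. K / ln (ln l) powr (1 + \<delta>) < 2) at_top"
    by (rule order_tendstoD) simp
  then have "eventually (\<lambda>l. K / ln (ln l) powr (1 + \<delta>) < 2 \<and> l \<ge> l\<^sub>0 \<and> l > 0) at_top"
    by (intro eventually_conj eventually_ge_at_top eventually_gt_at_top)
  then obtain l where l: "K / ln (ln l) powr (1 + \<delta>) < 2" "l \<ge> l\<^sub>0" "l > 0"
    using eventually_happens by force
  \<comment> \<open>Centring at \<open>b + l\<close> puts the whole window inside the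
    half-line.\<close>
  have "S \<inter> {b + l - l..b + l + l} = {b..b + 2 * l}" using sub by auto
  then have "measure lborel (S \<inter> {b + l - l..b + l + l}) = 2 * l"
    using l by simp
  then have "2 * l \<le> K / ln (ln l) powr (1 + \<delta>) * l"
    using thin[OF l(2,3), of "b + l"] by linarith
  moreover have "K / ln (ln l) powr (1 + \<delta>) * l < 2 * l"
    using l by (intro mult_strict_right_mono)
  ultimately show False by linarith
qed

text \<open>The last square alone outgrows the number of summands, so the averages even tend to
  infinity.\<close>

lemma limsup_eq_infinity_of_ge:
  fixes y b :: "nat \<Rightarrow> real"
  assumes le: "\<And>t. b t \<le> (y (Suc t))\<^sup>2"
    and lim: "filterlim (\<lambda>t. b t / real (Suc t)) at_top sequentially"
  shows "limsup (\<lambda>t. ereal (1 / real t * (\<Sum>i=1..t. (y i)\<^sup>2))) = \<infinity>"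
proof -
  let ?a = "\<lambda>t. 1 / real t * (\<Sum>i=1..t. (y i)\<^sup>2)"
  have "filterlim (\<lambda>t. ?a (Suc t)) at_top sequentially"
  proof (rule filterlim_at_top_mono[OF lim], rule always_eventually, rule allI)
    fix t
    have "(y (Suc t))\<^sup>2 \<le> (\<Sum>i=1..Suc t. (y i)\<^sup>2)"
      by (rule member_le_sum) auto
    then have "b t \<le> (\<Sum>i=1..Suc t. (y i)\<^sup>2)" using le[of t] by simp
    then show "b t / real (Suc t) \<le> ?a (Suc t)"
      by (simp add: divide_right_mono)
  qed
  then have "filterlim ?a at_top sequentially" by (rule filterlim_sequentially_Suc[THEN iffD1])
  then have "((\<lambda>t. ereal (?a t)) \<longlongrightarrow> \<infinity>) sequentially"
    by (simp add: tendsto_PInfty_eq_at_top)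
  then show ?thesis by (intro lim_imp_Limsup) auto
qed

text \<open>Preimages under a constant are empty or the whole space. This makes deterministic
  initial values admissible.\<close>

lemma (in prob_space) indep_variables_const:
  assumes Y: "Y \<in> M \<rightarrow>\<^sub>M T"
  shows "indep_variables M borel (\<lambda>_. c :: real) T Y"
proof -
  have "indep_set (sets (vimage_algebra (space M) (\<lambda>_. c) borel)) (sets (vimage_algebra (space M) Y T))"
  proof (rule indep_setI)
    show "sets (vimage_algebra (space M) (\<lambda>_. c) borel) \<subseteq> events"
      by (rule sets_image_in_sets) auto
    show "sets (vimage_algebra (space M) Y T) \<subseteq> events"
      by (rule sets_image_in_sets) (use Y in auto)
    fix A B assume A: "A \<in> sets (vimage_algebra (space M) (\<lambda>_. c) borel)"
      and B: "B \<in> sets (vimage_algebra (space M) Y T)"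
    then have "B \<subseteq> space M" using sets.sets_into_space by fastforce
    moreover have "A = {} \<or> A = space M"
      using A by (subst (asm) sets_vimage_algebra2) (auto split: if_splits)
    ultimately show "prob (A \<inter> B) = prob A * prob B"
      by (auto simp: prob_space Int_absorb1)
  qed
  then show ?thesis using Y unfolding indep_variables_def by auto
qed

text \<open>If \<open>h\<close> never reached \<open>z\<close>, its inverse there would be an
  infimum over the empty set, that is infinity, and so would the weighted gap.\<close>

lemma exists_large_value:
  assumes fin: "ennreal (z powr s) * growth_gap h z \<le> ennreal g" and z: "z > 0"
  shows "\<exists>x\<ge>0. z \<le> h x"
proof (rule ccontr)
  assume "\<not> ?thesis"
  then have "half_line_inverse h z = \<top>"
    by (auto simp: half_line_inverse_def)
  then have "ennreal (z powr s) * growth_gap h z = \<top>"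
    using z by (simp add: growth_gap_def ennreal_mult_top)
  then show False using fin by (simp add: top_unique)
qed

section \<open>Feedback laws and independence of the inputs\<close>

abbreviation sequence_space :: "(nat \<Rightarrow> real) measure" where
  "sequence_space \<equiv> Pi\<^sub>M UNIV (\<lambda>_. borel)"

lemma measurable_sequence_update [measurable]:
  assumes [measurable]: "g \<in> N \<rightarrow>\<^sub>M sequence_space" "k \<in> borel_measurable N"
  shows "(\<lambda>x. (g x)(i := k x)) \<in> N \<rightarrow>\<^sub>M sequence_space"
  by (rule measurable_fun_upd[where J = UNIV]) auto

lemma feedback_law_measurable:
  assumes "feedback_law u"
  shows "u t \<in> borel_measurable sequence_space"
proof -
  have "(\<lambda>p. p) \<in> sequence_space \<rightarrow>\<^sub>M output_algebra UNIV (\<lambda>i p. p i) t"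
    unfolding output_algebra_def
  proof (rule measurable_measure_of)
    fix X :: "(nat \<Rightarrow> real) set"
    assume "X \<in> {(\<lambda>p. p i) -` B \<inter> UNIV | i B. i \<le> t \<and> B \<in> sets borel}"
    then obtain i B where "X = (\<lambda>p. p i) -` B" and [measurable]: "B \<in> sets borel"
      by auto
    moreover have "(\<lambda>p. p i) -` B \<inter> space sequence_space \<in> sets sequence_space"
      by measurable
    ultimately show "(\<lambda>p. p) -` X \<inter> space sequence_space \<in> sets sequence_space"
      by simp
  qed auto
  then show ?thesis
    by (rule measurable_compose) (use assms in \<open>simp add: feedback_law_def\<close>)
qed

text \<open>Replacing the coordinates after \<open>t\<close> by zeros leaves the generators of the
  \<sigma>-algebra unchanged, so by factorization \<open>u t\<close> is a function of the truncated
  sequence.\<close>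

lemma feedback_law_cong:
  assumes "feedback_law u" and eq: "\<And>i. i \<le> t \<Longrightarrow> p i = q i"
  shows "u t p = u t q"
proof -
  let ?tr = "\<lambda>p i. if i \<le> t then p i else 0 :: real"
  have "{(\<lambda>p. p i) -` B \<inter> UNIV | i B. i \<le> t \<and> B \<in> sets borel} =
      {(\<lambda>p. ?tr p i) -` B \<inter> UNIV | i B. i \<le> t \<and> B \<in> sets borel}"
    by (intro Collect_cong ex_cong1) auto
  then have "output_algebra UNIV (\<lambda>i p. p i) t = output_algebra UNIV (\<lambda>i p. ?tr p i) t"
    by (simp add: output_algebra_def)
  then have "u t \<in> borel_measurable (output_algebra UNIV (\<lambda>i p. ?tr p i) t)"
    using assms(1) unfolding feedback_law_def by metis
  then obtain v where v: "u t p = v (?tr p)" for p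
    unfolding measurable_output_algebra_iff by auto
  have "?tr p = ?tr q" using eq by auto
  then show ?thesis by (simp add: v)
qed

text \<open>The loop under one fixed control law, started from the deterministic output
  \<open>c\<close>.\<close>

locale gaussian_control_loop = prob_space M
  for M :: "'a measure" +
  fixes f :: "real \<Rightarrow> real" and \<theta> :: "'a \<Rightarrow> real" and w :: "nat \<Rightarrow> 'a \<Rightarrow> real"
    and u :: "nat \<Rightarrow> (nat \<Rightarrow> real) \<Rightarrow> real" and \<theta>\<^sub>0 P\<^sub>0 c :: real
  assumes f[measurable]: "f \<in> borel_measurable borel"
    and noise_indep: "indep_vars (\<lambda>_. borel) w {1..}"
    and noise_dist: "t \<ge> 1 \<Longrightarrow> distributed M lborel (w t) std_normal_density"
    and P\<^sub>0: "P\<^sub>0 > 0"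
    and \<theta>_dist: "distributed M lborel \<theta> (normal_density \<theta>\<^sub>0 (sqrt P\<^sub>0))"
    and \<theta>_indep: "indep_variables M borel \<theta> noise_space (noise w)"
    and u: "feedback_law u"
begin

lemma u_measurable[measurable]: "u t \<in> borel_measurable sequence_space"
  using u by (rule feedback_law_measurable)

lemma \<theta>_measurable[measurable]: "\<theta> \<in> borel_measurable M"
  using distributed_measurable[OF \<theta>_dist] by simp

text \<open>The noise starts at time 1, which leaves index 0 for the parameter; all randomness
  becomes one sequence.\<close>

definition input :: "'a \<Rightarrow> nat \<Rightarrow> real" where
  "input \<omega> i = (if i = 0 then \<theta> \<omega> else w i \<omega>)"

text \<open>The noises are independent of each other and \<theta> is independent of their whole
  sequence; the product formula over a finite index set follows by splitting off the index
  0.\<close>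

lemma indep_input: "indep_vars (\<lambda>_. borel) (\<lambda>i \<omega>. input \<omega> i) UNIV"
proof -
  let ?E = "\<lambda>i. {(\<lambda>\<omega>. input \<omega> i) -` A \<inter> space M |A. A \<in> sets borel}"
  have rv: "random_variable borel (\<lambda>\<omega>. input \<omega> i)" for i
    using noise_indep unfolding indep_vars_def input_def by (cases "i = 0") auto
  have "indep_sets ?E UNIV"
    unfolding indep_sets_def
  proof (intro conjI ballI allI impI)
    fix i
    show "?E i \<subseteq> events"
      using measurable_sets[OF rv] by blast
  next
    fix J :: "nat set" and A assume J: "J \<noteq> {}" "finite J" and A: "A \<in> Pi J ?E"
    have noise: "prob (\<Inter>j\<in>K. A j) = (\<Prod>j\<in>K. prob (A j))"
      if K: "K \<subseteq> J" "K \<noteq> {}" "0 \<notin> K" for K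
    proof (rule indep_setsD)
      show "indep_sets (\<lambda>i. {w i -` A \<inter> space M |A. A \<in> sets borel}) {1..}"
        using noise_indep unfolding indep_vars_def2 by blast
      show "K \<subseteq> {1..}" using that by (auto simp: Suc_le_eq intro: gr0I)
      show "\<forall>j\<in>K. A j \<in> {w j -` A \<inter> space M |A. A \<in> sets borel}"
      proof
        fix j assume "j \<in> K"
        then have "A j \<in> ?E j" "j \<noteq> 0" using A K by auto
        then show "A j \<in> {w j -` A \<inter> space M |A. A \<in> sets borel}"
          by (simp add: input_def)
      qed
    qed (use that J finite_subset in auto)
    show "prob (\<Inter>j\<in>J. A j) = (\<Prod>j\<in>J. prob (A j))"
    proof (cases "0 \<in> J \<and> J - {0} \<noteq> {}")
      case False
      show ?thesis
      proof (cases "0 \<in> J")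
        case True then have "J = {0}" using False by auto
        then show ?thesis by simp
      next
        case False then show ?thesis using noise[of J] J by simp
      qed
    next
      case True
      let ?K = "J - {0}"
      obtain B0 where B0: "B0 \<in> sets borel" "A 0 = \<theta> -` B0 \<inter> space M"
      proof -
        have "A 0 \<in> ?E 0" using A True by blast
        then show ?thesis using that by (auto simp: input_def)
      qed
      have "\<forall>j\<in>?K. \<exists>B. B \<in> sets borel \<and> A j = w j -` B \<inter> space M"
        using A by (fastforce simp: input_def Pi_def)
      then obtain B where B: "\<And>j. j \<in> ?K \<Longrightarrow> B j \<in> sets borel \<and> A j = w j -` B j \<inter> space M"
        by metis
      \<comment> \<open>The noise events are gathered into one event of the noise sequence, to which
        the independence from \<theta> applies.\<close>
      let ?C = "\<Inter>j\<in>?K. {z \<in> space noise_space. z j \<in> B j}"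
      have C: "?C \<in> sets noise_space"
      proof (rule sets.finite_INT)
        fix j assume j: "j \<in> ?K"
        then have [measurable]: "B j \<in> sets borel" "j \<in> {1..}" using B by auto
        show "{z \<in> space noise_space. z j \<in> B j} \<in> sets noise_space"
          by measurable
      qed (use J True in auto)
      have "(\<Inter>j\<in>?K. A j) = noise w -` ?C \<inter> space M"
        using B True by (auto simp: space_PiM)
      moreover have "indep_set (sets (vimage_algebra (space M) \<theta> borel))
          (sets (vimage_algebra (space M) (noise w) noise_space))"
        using \<theta>_indep unfolding indep_variables_def by blast
      then have "prob ((\<theta> -` B0 \<inter> space M) \<inter> (noise w -` ?C \<inter> space M)) =
          prob (\<theta> -` B0 \<inter> space M) * prob (noise w -` ?C \<inter> space M)"
        by (rule indep_setD[OF _ in_vimage_algebra[OF B0(1)] in_vimage_algebra[OF C]])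
      moreover have "(\<Inter>j\<in>J. A j) = A 0 \<inter> (\<Inter>j\<in>?K. A j)"
        using True by auto
      moreover have "(\<Prod>j\<in>J. prob (A j)) = prob (A 0) * (\<Prod>j\<in>?K. prob (A j))"
        using True J by (intro prod.remove) auto
      ultimately show ?thesis using noise[of ?K] True B0 by auto
    qed
  qed
  then show ?thesis
    using rv unfolding indep_vars_def2 by auto
qed

text \<open>The entries beyond time \<open>t\<close> are filled with zeros, so that all histories live in one space.\<close>

fun trajectory :: "nat \<Rightarrow> (nat \<Rightarrow> real) \<Rightarrow> nat \<Rightarrow> real" where
  "trajectory 0 z = (\<lambda>_. 0)(0 := c)"
| "trajectory (Suc t) z = (trajectory t z)
     (Suc t := z 0 * f (trajectory t z t) + u t (trajectory t z) + z (Suc t))"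

text \<open>Outputs up to \<open>t\<close> read only inputs up to \<open>t\<close>. The slack
  \<open>k\<close> lets the induction pass from \<open>Suc t + k\<close> to
  \<open>t + Suc k\<close>.\<close>

lemma trajectory_restrict: "trajectory t (restrict z {..t + k}) = trajectory t z"
proof (induction t arbitrary: k)
  case (Suc t)
  have "trajectory t (restrict z {..Suc t + k}) = trajectory t z"
    using Suc[of "Suc k"] by (simp only: add_Suc_right add_Suc)
  then show ?case by (simp only: trajectory.simps) simp
qed simp

lemma measurable_trajectory:
  "t \<le> k \<Longrightarrow> trajectory t \<in> Pi\<^sub>M {..k} (\<lambda>_. borel) \<rightarrow>\<^sub>M sequence_space"
proof (induction t)
  case 0
  then show ?case by (auto intro!: measurable_PiM_single')
next
  case (Suc t)
  then have [measurable]: "trajectory t \<in> Pi\<^sub>M {..k} (\<lambda>_. borel) \<rightarrow>\<^sub>M sequence_space"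
    and [measurable]: "Suc t \<in> {..k}" "0 \<in> {..k}" by auto
  have "trajectory (Suc t) = (\<lambda>z. (trajectory t z)
      (Suc t := z 0 * f (trajectory t z t) + u t (trajectory t z) + z (Suc t)))"
    by (rule ext) simp
  also have "\<dots> \<in> Pi\<^sub>M {..k} (\<lambda>_. borel) \<rightarrow>\<^sub>M sequence_space"
    by measurable
  finally show ?case .
qed

definition history :: "nat \<Rightarrow> 'a \<Rightarrow> nat \<Rightarrow> real" where
  "history t \<omega> = trajectory t (input \<omega>)"

lemma history_0 [simp]: "history 0 \<omega> = (\<lambda>_. 0)(0 := c)"
  by (simp add: history_def)

lemma history_Suc:
  "history (Suc t) \<omega> = (history t \<omega>)
     (Suc t := \<theta> \<omega> * f (history t \<omega> t) + u t (history t \<omega>) + w (Suc t) \<omega>)"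
  by (simp add: history_def input_def)

lemma indep_input_Suc:
  "indep_var (Pi\<^sub>M {..t} (\<lambda>_. borel)) (\<lambda>\<omega>. restrict (input \<omega>) {..t})
     (Pi\<^sub>M {Suc t} (\<lambda>_. borel)) (\<lambda>\<omega>. restrict (input \<omega>) {Suc t})"
  by (rule indep_var_restrict[OF indep_input, of "{..t}" "{Suc t}"]) auto

lemma trajectory_restrict_input: "trajectory t (restrict (input \<omega>) {..t}) = history t \<omega>"
  using trajectory_restrict[of t _ 0] by (simp add: history_def)

lemma measurable_history[measurable]: "history t \<in> M \<rightarrow>\<^sub>M sequence_space"
  using measurable_compose[OF indep_var_rv1[OF indep_input_Suc] measurable_trajectory[of t t]]
  by (simp add: trajectory_restrict_input)

text \<open>The transition kernel: \<open>w (Suc t)\<close> is independent of all earlier inputs and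
  can be integrated out, leaving a unit-variance Gaussian around the noiseless next output.\<close>

lemma nn_integral_history_Suc:
  assumes [measurable]: "\<phi> \<in> borel_measurable (borel \<Otimes>\<^sub>M sequence_space)"
  shows "(\<integral>\<^sup>+\<omega>. \<phi> (\<theta> \<omega>, history (Suc t) \<omega>) \<partial>M) =
    (\<integral>\<^sup>+\<omega>. (\<integral>\<^sup>+v. ennreal (normal_density (\<theta> \<omega> * f (history t \<omega> t) + u t (history t \<omega>)) 1 v) *
        \<phi> (\<theta> \<omega>, (history t \<omega>)(Suc t := v)) \<partial>lborel) \<partial>M)"
proof -
  let ?L = "Pi\<^sub>M {..t} (\<lambda>_. borel :: real measure)" and ?R = "Pi\<^sub>M {Suc t} (\<lambda>_. borel :: real measure)"
  let ?X = "\<lambda>\<omega>. restrict (input \<omega>) {..t}" and ?W = "\<lambda>\<omega>. restrict (input \<omega>) {Suc t}"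
  have [measurable]: "trajectory t \<in> ?L \<rightarrow>\<^sub>M sequence_space" and [measurable]: "0 \<in> {..t}"
    by (auto intro: measurable_trajectory)
  have [measurable]: "?X \<in> M \<rightarrow>\<^sub>M ?L" "?W \<in> M \<rightarrow>\<^sub>M ?R"
    using indep_var_rv1[OF indep_input_Suc] indep_var_rv2[OF indep_input_Suc] by auto
  define m where "m q = q 0 * f (trajectory t q t) + u t (trajectory t q)" for q
  have [measurable]: "m \<in> borel_measurable ?L" unfolding m_def by measurable
  have m_X: "m (?X \<omega>) = \<theta> \<omega> * f (history t \<omega> t) + u t (history t \<omega>)" for \<omega>
    by (simp add: m_def trajectory_restrict_input) (simp add: input_def)
  interpret W: prob_space "distr M ?R ?W" by (rule prob_space_distr) simp
  define \<psi> where "\<psi> q v = \<phi> (q 0, (trajectory t q)(Suc t := m q + v))" for q v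
  have \<psi>_X: "\<psi> (?X \<omega>) v = \<phi> (\<theta> \<omega>, (history t \<omega>)(Suc t := m (?X \<omega>) + v))" for \<omega> v
    by (simp add: \<psi>_def trajectory_restrict_input) (simp add: input_def)
  have [measurable]: "(\<lambda>q. \<psi> (fst q) (snd q (Suc t))) \<in> borel_measurable (?L \<Otimes>\<^sub>M ?R)"
    unfolding \<psi>_def by measurable
  have "(\<integral>\<^sup>+\<omega>. \<phi> (\<theta> \<omega>, history (Suc t) \<omega>) \<partial>M) =
      (\<integral>\<^sup>+\<omega>. (\<lambda>q. \<psi> (fst q) (snd q (Suc t))) (?X \<omega>, ?W \<omega>) \<partial>M)"
    by (simp add: history_Suc \<psi>_X m_X) (simp add: input_def)
  also have "\<dots> = (\<integral>\<^sup>+q. \<psi> (fst q) (snd q (Suc t)) \<partial>distr M (?L \<Otimes>\<^sub>M ?R) (\<lambda>\<omega>. (?X \<omega>, ?W \<omega>)))"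
    by (subst nn_integral_distr) auto
  \<comment> \<open>Independence enters here: the joint law of past and next input is a
    product.\<close>
  also have "\<dots> = (\<integral>\<^sup>+q. \<psi> (fst q) (snd q (Suc t)) \<partial>(distr M ?L ?X \<Otimes>\<^sub>M distr M ?R ?W))"
    using indep_input_Suc[of t] by (simp add: indep_var_distribution_eq)
  also have "\<dots> = (\<integral>\<^sup>+q. (\<integral>\<^sup>+z. \<psi> q (z (Suc t)) \<partial>distr M ?R ?W) \<partial>distr M ?L ?X)"
    by (subst W.nn_integral_fst[symmetric]) simp_all
  also have "\<dots> = (\<integral>\<^sup>+\<omega>. (\<integral>\<^sup>+z. \<psi> (?X \<omega>) (z (Suc t)) \<partial>distr M ?R ?W) \<partial>M)"
  proof (rule nn_integral_distr)
    have "(\<lambda>q. \<integral>\<^sup>+z. (\<lambda>q. \<psi> (fst q) (snd q (Suc t))) (q, z) \<partial>distr M ?R ?W) \<in> borel_measurable ?L"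
      by (rule W.borel_measurable_nn_integral_fst) simp
    then show "(\<lambda>q. \<integral>\<^sup>+z. \<psi> q (z (Suc t)) \<partial>distr M ?R ?W) \<in> borel_measurable (distr M ?L ?X)"
      by simp
  qed simp
  also have "\<dots> = (\<integral>\<^sup>+\<omega>. (\<integral>\<^sup>+v. ennreal (normal_density (m (?X \<omega>)) 1 v) *
        \<phi> (\<theta> \<omega>, (history t \<omega>)(Suc t := v)) \<partial>lborel) \<partial>M)"
  proof (rule nn_integral_cong)
    fix \<omega> assume \<omega>: "\<omega> \<in> space M"
    have [measurable]: "(\<lambda>v. \<phi> (\<theta> \<omega>, (history t \<omega>)(Suc t := k v))) \<in> borel_measurable borel"
      if [measurable]: "k \<in> borel_measurable borel" for k
    proof -
      have [measurable]: "history t \<omega> \<in> space sequence_space" by (simp add: space_PiM)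
      show ?thesis by measurable
    qed
    have [measurable]: "(\<lambda>v. \<psi> (?X \<omega>) v) \<in> borel_measurable borel"
      unfolding \<psi>_X by measurable
    have "(\<integral>\<^sup>+z. \<psi> (?X \<omega>) (z (Suc t)) \<partial>distr M ?R ?W) = (\<integral>\<^sup>+\<omega>'. \<psi> (?X \<omega>) (w (Suc t) \<omega>') \<partial>M)"
      by (subst nn_integral_distr) (auto simp: input_def[of _ "Suc t"])
    also have "\<dots> = (\<integral>\<^sup>+v. ennreal (std_normal_density v) * \<psi> (?X \<omega>) v \<partial>lborel)"
      by (rule distributed_nn_integral[OF noise_dist, symmetric]) auto
    \<comment> \<open>Translation by the conditional mean turns the noise variable into the output
      variable.\<close>
    also have "\<dots> = (\<integral>\<^sup>+v. ennreal (normal_density (m (?X \<omega>)) 1 v) *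
        \<phi> (\<theta> \<omega>, (history t \<omega>)(Suc t := v)) \<partial>lborel)"
      by (subst (2) nn_integral_real_affine[where c = 1 and t = "m (?X \<omega>)"])
        (auto simp: \<psi>_X normal_density_def)
    finally show "(\<integral>\<^sup>+z. \<psi> (?X \<omega>) (z (Suc t)) \<partial>distr M ?R ?W) =
      (\<integral>\<^sup>+v. ennreal (normal_density (m (?X \<omega>)) 1 v) *
        \<phi> (\<theta> \<omega>, (history t \<omega>)(Suc t := v)) \<partial>lborel)" .
  qed
  finally show ?thesis by (simp only: m_X)
qed

section \<open>Posterior and prediction\<close>

definition precision :: "nat \<Rightarrow> (nat \<Rightarrow> real) \<Rightarrow> real" where
  "precision t p = 1 / P\<^sub>0 + (\<Sum>i<t. (f (p i))\<^sup>2)"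

text \<open>The posterior mean, which is least squares regularized by the prior:
  \<open>p (Suc i) - u i p\<close> observes \<theta> with regressor \<open>f (p i)\<close> and unit
  noise.\<close>

definition estimate :: "nat \<Rightarrow> (nat \<Rightarrow> real) \<Rightarrow> real" where
  "estimate t p = (\<theta>\<^sub>0 / P\<^sub>0 + (\<Sum>i<t. f (p i) * (p (Suc i) - u i p))) / precision t p"

text \<open>The predictive standard deviation: parameter uncertainty and noise contribute the
  variance \<open>(f (p t))^2 / precision t p + 1\<close>.\<close>

definition spread :: "nat \<Rightarrow> (nat \<Rightarrow> real) \<Rightarrow> real" where
  "spread t p = sqrt (precision (Suc t) p / precision t p)"

abbreviation posterior_density :: "nat \<Rightarrow> (nat \<Rightarrow> real) \<Rightarrow> real \<Rightarrow> ennreal" where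
  "posterior_density t p x \<equiv> ennreal (normal_density (estimate t p) (1 / sqrt (precision t p)) x)"

abbreviation prediction_density :: "nat \<Rightarrow> (nat \<Rightarrow> real) \<Rightarrow> real \<Rightarrow> ennreal" where
  "prediction_density t p v \<equiv> ennreal (normal_density (estimate t p * f (p t) + u t p) (spread t p) v)"

lemma precision_pos: "precision t p > 0"
  unfolding precision_def using P\<^sub>0 by (intro add_pos_nonneg sum_nonneg) auto

lemma precision_Suc: "precision (Suc t) p = precision t p + (f (p t))\<^sup>2"
  by (simp add: precision_def)

lemma precision_cong: "(\<And>i. i < t \<Longrightarrow> p i = q i) \<Longrightarrow> precision t p = precision t q"
  unfolding precision_def by simp

lemma spread_cong: "(\<And>i. i \<le> t \<Longrightarrow> p i = q i) \<Longrightarrow> spread t p = spread t q"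
  unfolding spread_def using precision_cong[of t p q] precision_cong[of "Suc t" p q] by simp

lemma measurable_precision[measurable]: "precision t \<in> borel_measurable sequence_space"
  unfolding precision_def[abs_def] by measurable

lemma measurable_estimate[measurable]: "estimate t \<in> borel_measurable sequence_space"
  unfolding estimate_def[abs_def] by measurable

lemma measurable_spread[measurable]: "spread t \<in> borel_measurable sequence_space"
  unfolding spread_def[abs_def] by measurable

lemma precision_update: "precision (Suc t) (p(Suc t := v)) = precision t p + (f (p t))\<^sup>2"
  using precision_cong[of "Suc t" "p(Suc t := v)" p] by (simp add: precision_Suc)

text \<open>The recursive least squares step. Controls up to time \<open>t\<close> do not see the
  new entry, so the old numerator is \<open>precision t p * estimate t p\<close>.\<close>

lemma estimate_update:
  "estimate (Suc t) (p(Suc t := v)) =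
    (precision t p * estimate t p + f (p t) * (v - u t p)) / (precision t p + (f (p t))\<^sup>2)"
proof -
  have u_eq: "u i (p(Suc t := v)) = u i p" if "i \<le> t" for i
    by (rule feedback_law_cong[OF u]) (use that in auto)
  have "(\<Sum>i<Suc t. f ((p(Suc t := v)) i) * ((p(Suc t := v)) (Suc i) - u i (p(Suc t := v)))) =
      (\<Sum>i<t. f (p i) * (p (Suc i) - u i p)) + f (p t) * (v - u t p)"
    by (simp add: u_eq)
  then show ?thesis
    using precision_pos[of t p]
    by (simp add: estimate_def precision_update)
qed

text \<open>The next output is drawn from its prediction first and the parameter from the updated
  posterior afterwards. The posterior at time \<open>t\<close> is a premise so that the step can
  serve inside the induction that establishes it.\<close>

lemma posterior_step:
  assumes posterior: "\<And>\<phi>. \<phi> \<in> borel_measurable (borel \<Otimes>\<^sub>M sequence_space) \<Longrightarrow>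
      (\<integral>\<^sup>+\<omega>. \<phi> (\<theta> \<omega>, history t \<omega>) \<partial>M) =
      (\<integral>\<^sup>+\<omega>. (\<integral>\<^sup>+x. posterior_density t (history t \<omega>) x * \<phi> (x, history t \<omega>) \<partial>lborel) \<partial>M)"
    and [measurable]: "\<phi> \<in> borel_measurable (borel \<Otimes>\<^sub>M sequence_space)"
  shows "(\<integral>\<^sup>+\<omega>. \<phi> (\<theta> \<omega>, history (Suc t) \<omega>) \<partial>M) =
    (\<integral>\<^sup>+\<omega>. (\<integral>\<^sup>+v. prediction_density t (history t \<omega>) v *
       (\<integral>\<^sup>+x. posterior_density (Suc t) ((history t \<omega>)(Suc t := v)) x *
         \<phi> (x, (history t \<omega>)(Suc t := v)) \<partial>lborel) \<partial>lborel) \<partial>M)"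
proof -
  define \<psi> where "\<psi> q = (\<integral>\<^sup>+v. ennreal (normal_density (fst q * f (snd q t) + u t (snd q)) 1 v) *
        \<phi> (fst q, (snd q)(Suc t := v)) \<partial>lborel)" for q
  have [measurable]: "\<psi> \<in> borel_measurable (borel \<Otimes>\<^sub>M sequence_space)"
    unfolding \<psi>_def by measurable
  have "(\<integral>\<^sup>+\<omega>. \<phi> (\<theta> \<omega>, history (Suc t) \<omega>) \<partial>M) = (\<integral>\<^sup>+\<omega>. \<psi> (\<theta> \<omega>, history t \<omega>) \<partial>M)"
    by (simp add: nn_integral_history_Suc \<psi>_def)
  also have "\<dots> = (\<integral>\<^sup>+\<omega>. (\<integral>\<^sup>+x. posterior_density t (history t \<omega>) x * \<psi> (x, history t \<omega>) \<partial>lborel) \<partial>M)"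
    by (rule posterior) simp
  also have "\<dots> = (\<integral>\<^sup>+\<omega>. (\<integral>\<^sup>+v. prediction_density t (history t \<omega>) v *
       (\<integral>\<^sup>+x. posterior_density (Suc t) ((history t \<omega>)(Suc t := v)) x *
         \<phi> (x, (history t \<omega>)(Suc t := v)) \<partial>lborel) \<partial>lborel) \<partial>M)"
  proof (rule nn_integral_cong)
    fix \<omega>
    define p where "p = history t \<omega>"
    have [measurable]: "p \<in> space sequence_space" by (simp add: space_PiM)
    let ?N = "\<lambda>x. posterior_density t p x"
    let ?K = "\<lambda>x v. ennreal (normal_density (x * f (p t) + u t p) 1 v)"
    let ?V = "\<lambda>v. prediction_density t p v"
    let ?N' = "\<lambda>x v. posterior_density (Suc t) (p(Suc t := v)) x"
    have bayes: "?N x * ?K x v = ?V v * ?N' x v" for x v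
      using normal_density_mult_eq[OF precision_pos[of t p], of "estimate t p" x "f (p t)" "u t p" v]
      by (simp add: ennreal_mult[symmetric] estimate_update precision_update
          spread_def precision_Suc[of t p])
    have "(\<integral>\<^sup>+x. ?N x * \<psi> (x, p) \<partial>lborel) = (\<integral>\<^sup>+x. (\<integral>\<^sup>+v. ?N x * (?K x v * \<phi> (x, p(Suc t := v))) \<partial>lborel) \<partial>lborel)"
      unfolding \<psi>_def by (simp add: nn_integral_cmult)
    \<comment> \<open>Tonelli puts the parameter integral inside, where Bayes' rule can be applied
      pointwise.\<close>
    also have "\<dots> = (\<integral>\<^sup>+v. (\<integral>\<^sup>+x. ?N x * (?K x v * \<phi> (x, p(Suc t := v))) \<partial>lborel) \<partial>lborel)"
      by (rule lborel_pair.Fubini') measurable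
    also have "\<dots> = (\<integral>\<^sup>+v. (\<integral>\<^sup>+x. ?V v * (?N' x v * \<phi> (x, p(Suc t := v))) \<partial>lborel) \<partial>lborel)"
      by (simp only: mult.assoc[symmetric] bayes)
    also have "\<dots> = (\<integral>\<^sup>+v. ?V v * (\<integral>\<^sup>+x. ?N' x v * \<phi> (x, p(Suc t := v)) \<partial>lborel) \<partial>lborel)"
      by (simp add: nn_integral_cmult)
    finally show "(\<integral>\<^sup>+x. posterior_density t (history t \<omega>) x * \<psi> (x, history t \<omega>) \<partial>lborel) =
       (\<integral>\<^sup>+v. prediction_density t (history t \<omega>) v *
       (\<integral>\<^sup>+x. posterior_density (Suc t) ((history t \<omega>)(Suc t := v)) x *
         \<phi> (x, (history t \<omega>)(Suc t := v)) \<partial>lborel) \<partial>lborel)"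
      unfolding p_def .
  qed
  finally show ?thesis .
qed

text \<open>The conditional law of \<theta> given the outputs, expressed through integrals of test
  functions.\<close>

lemma posterior:
  assumes "\<phi> \<in> borel_measurable (borel \<Otimes>\<^sub>M sequence_space)"
  shows "(\<integral>\<^sup>+\<omega>. \<phi> (\<theta> \<omega>, history t \<omega>) \<partial>M) =
      (\<integral>\<^sup>+\<omega>. (\<integral>\<^sup>+x. posterior_density t (history t \<omega>) x * \<phi> (x, history t \<omega>) \<partial>lborel) \<partial>M)"
  using assms
proof (induction t arbitrary: \<phi>)
  case 0
  then have [measurable]: "\<phi> \<in> borel_measurable (borel \<Otimes>\<^sub>M sequence_space)" .
  let ?p = "(\<lambda>_. 0)(0 := c) :: nat \<Rightarrow> real"
  have [measurable]: "?p \<in> space sequence_space" by (simp add: space_PiM)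
  have "estimate 0 ?p = \<theta>\<^sub>0" "1 / sqrt (precision 0 ?p) = sqrt P\<^sub>0"
    using P\<^sub>0 by (simp_all add: estimate_def precision_def real_sqrt_divide)
  moreover have "(\<integral>\<^sup>+x. ennreal (normal_density \<theta>\<^sub>0 (sqrt P\<^sub>0) x) * \<phi> (x, ?p) \<partial>lborel) =
      (\<integral>\<^sup>+\<omega>. \<phi> (\<theta> \<omega>, ?p) \<partial>M)"
    by (rule distributed_nn_integral[OF \<theta>_dist]) measurable
  ultimately show ?case
    by (simp add: emeasure_space_1 del: fun_upd_apply)
next
  case (Suc t)
  note [measurable] = Suc.prems
  define \<eta> where "\<eta> q = (\<integral>\<^sup>+x. posterior_density (Suc t) (snd q) x * \<phi> (x, snd q) \<partial>lborel)" for q :: "real \<times> (nat \<Rightarrow> real)"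
  have [measurable]: "\<eta> \<in> borel_measurable (borel \<Otimes>\<^sub>M sequence_space)"
    unfolding \<eta>_def by measurable
  \<comment> \<open>\<open>\<eta>\<close> ignores its first argument and the posterior has mass one.
    Hence \<open>posterior_step\<close> gives the same right-hand side for \<open>\<eta>\<close> as
    for \<open>\<phi>\<close>.\<close>
  have "(\<integral>\<^sup>+x. posterior_density (Suc t) p x * \<eta> (x, p) \<partial>lborel) = \<eta> (0, p)" for p
    by (simp add: \<eta>_def nn_integral_multc nn_integral_normal_density_eq_1 precision_pos)
  then have "(\<integral>\<^sup>+\<omega>. \<eta> (\<theta> \<omega>, history (Suc t) \<omega>) \<partial>M) =
    (\<integral>\<^sup>+\<omega>. (\<integral>\<^sup>+v. prediction_density t (history t \<omega>) v * \<eta> (0, (history t \<omega>)(Suc t := v)) \<partial>lborel) \<partial>M)"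
    by (subst posterior_step[OF Suc.IH]) simp_all
  also have "\<dots> = (\<integral>\<^sup>+\<omega>. \<phi> (\<theta> \<omega>, history (Suc t) \<omega>) \<partial>M)"
    by (subst posterior_step[OF Suc.IH]) (simp_all add: \<eta>_def)
  finally show ?case by (simp add: \<eta>_def)
qed

lemma nn_integral_prediction:
  assumes [measurable]: "\<eta> \<in> borel_measurable sequence_space"
  shows "(\<integral>\<^sup>+\<omega>. \<eta> (history (Suc t) \<omega>) \<partial>M) =
    (\<integral>\<^sup>+\<omega>. (\<integral>\<^sup>+v. prediction_density t (history t \<omega>) v * \<eta> ((history t \<omega>)(Suc t := v)) \<partial>lborel) \<partial>M)"
  using posterior_step[OF posterior, of "\<lambda>q. \<eta> (snd q)" t]
  by (simp add: nn_integral_multc nn_integral_normal_density_eq_1 precision_pos)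

text \<open>The control enters the prediction only through its mean, so a bound uniform in
  \<open>m\<close> holds for every law. By \<open>G_update\<close>, membership in \<open>G\<close>
  is settled before the new output is drawn.\<close>

lemma prob_exceptional_le:
  fixes G B :: "(nat \<Rightarrow> real) set"
  assumes G[measurable]: "G \<in> sets sequence_space" and B[measurable]: "B \<in> sets sequence_space"
    and G_update: "\<And>p v. p(Suc t := v) \<in> G \<longleftrightarrow> p \<in> G"
    and le: "\<And>\<omega> m. history t \<omega> \<in> G \<Longrightarrow>
      (\<integral>\<^sup>+v. ennreal (normal_density m (spread t (history t \<omega>)) v) *
         indicator B ((history t \<omega>)(Suc t := v)) \<partial>lborel) \<le> ennreal \<delta>"
  shows "emeasure M {\<omega> \<in> space M. history (Suc t) \<omega> \<in> G \<inter> B} \<le> ennreal \<delta>"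
proof -
  have [measurable]: "history (Suc t) \<in> M \<rightarrow>\<^sub>M sequence_space" by (rule measurable_history)
  have "emeasure M {\<omega> \<in> space M. history (Suc t) \<omega> \<in> G \<inter> B} =
      (\<integral>\<^sup>+\<omega>. indicator {\<omega> \<in> space M. history (Suc t) \<omega> \<in> G \<inter> B} \<omega> \<partial>M)"
    by (subst nn_integral_indicator) measurable
  also have "\<dots> = (\<integral>\<^sup>+\<omega>. indicator (G \<inter> B) (history (Suc t) \<omega>) \<partial>M)"
    by (intro nn_integral_cong) (simp add: indicator_def)
  also have "\<dots> = (\<integral>\<^sup>+\<omega>. (\<integral>\<^sup>+v. prediction_density t (history t \<omega>) v * indicator (G \<inter> B) ((history t \<omega>)(Suc t := v)) \<partial>lborel) \<partial>M)"
    by (rule nn_integral_prediction) simp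
  also have "\<dots> \<le> (\<integral>\<^sup>+\<omega>. ennreal \<delta> \<partial>M)"
  proof (rule nn_integral_mono)
    fix \<omega>
    let ?N = "\<lambda>v. prediction_density t (history t \<omega>) v"
    show "(\<integral>\<^sup>+v. ?N v * indicator (G \<inter> B) ((history t \<omega>)(Suc t := v)) \<partial>lborel) \<le> ennreal \<delta>"
      using le[of \<omega> "estimate t (history t \<omega>) * f (history t \<omega> t) + u t (history t \<omega>)"]
      by (cases "history t \<omega> \<in> G") (simp_all add: indicator_inter_arith G_update indicator_def)
  qed
  also have "\<dots> = ennreal \<delta>" by (simp add: emeasure_space_1)
  finally show ?thesis .
qed

section \<open>The realized output sequence and the event on which every step is good\<close>

definition outputs :: "'a \<Rightarrow> nat \<Rightarrow> real" where
  "outputs \<omega> i = history i \<omega> i"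

lemma history_eq_outputs: "i \<le> t \<Longrightarrow> history t \<omega> i = outputs \<omega> i"
proof (induction t)
  case (Suc t)
  then show ?case
    by (cases "i = Suc t") (simp_all add: outputs_def history_Suc)
qed (simp add: outputs_def)

lemma outputs_0: "outputs \<omega> 0 = c"
  by (simp add: outputs_def)

lemma outputs_Suc: "outputs \<omega> (Suc t) = \<theta> \<omega> * f (outputs \<omega> t) + u t (outputs \<omega>) + w (Suc t) \<omega>"
proof -
  have "u t (history t \<omega>) = u t (outputs \<omega>)"
    by (rule feedback_law_cong[OF u]) (simp add: history_eq_outputs)
  then show ?thesis
    by (simp add: outputs_def[of \<omega> "Suc t"] history_Suc) (simp add: outputs_def)
qed

text \<open>A union bound over the time of first failure: each bound \<open>d n\<close> is used only
  after \<open>n\<close> successes, which is what makes it available.\<close>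

lemma exists_event_all_good:
  fixes G :: "nat \<Rightarrow> (nat \<Rightarrow> real) set" and d :: "nat \<Rightarrow> real"
  assumes G: "\<And>t. G t \<in> sets sequence_space"
    and G_cong: "\<And>t p q. (\<And>i. i \<le> Suc t \<Longrightarrow> p i = q i) \<Longrightarrow> p \<in> G t \<longleftrightarrow> q \<in> G t"
    and le: "\<And>n \<omega> m. (\<And>t. t < n \<Longrightarrow> history n \<omega> \<in> G t) \<Longrightarrow>
      (\<integral>\<^sup>+v. ennreal (normal_density m (spread n (history n \<omega>)) v) *
         indicator (- G n) ((history n \<omega>)(Suc n := v)) \<partial>lborel) \<le> ennreal (d n)"
    and d: "\<And>n. d n \<ge> 0" "summable d" "suminf d < 1"
  shows "\<exists>D\<in>sets M. measure M D > 0 \<and> (\<forall>\<omega>\<in>D. \<forall>t. outputs \<omega> \<in> G t)"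
proof -
  note [measurable] = G
  have space: "space sequence_space = UNIV" by (simp add: space_PiM)
  define bad where "bad n = {\<omega> \<in> space M. history (Suc n) \<omega> \<in> {p. \<forall>t<n. p \<in> G t} \<inter> - G n}" for n
  have past[measurable]: "{p. \<forall>t<n. p \<in> G t} \<in> sets sequence_space" for n
  proof -
    have "{p \<in> space sequence_space. \<forall>t<n. p \<in> G t} \<in> sets sequence_space"
      by measurable
    then show ?thesis by (simp add: space)
  qed
  have comp[measurable]: "- G n \<in> sets sequence_space" for n
    using sets.compl_sets[OF G[of n]] by (simp add: space Compl_eq_Diff_UNIV)
  have [measurable]: "bad n \<in> sets M" for n
    unfolding bad_def by measurable
  have bad_le: "emeasure M (bad n) \<le> ennreal (d n)" for n
    unfolding bad_def
  proof (rule prob_exceptional_le)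
    fix p :: "nat \<Rightarrow> real" and v
    \<comment> \<open>For \<open>t < n\<close> the set \<open>G t\<close> sees coordinates up to
      \<open>Suc t \<le> n\<close> only.\<close>
    have "p(Suc n := v) \<in> G t \<longleftrightarrow> p \<in> G t" if "t < n" for t
      by (rule G_cong) (use that in auto)
    then show "p(Suc n := v) \<in> {p. \<forall>t<n. p \<in> G t} \<longleftrightarrow> p \<in> {p. \<forall>t<n. p \<in> G t}"
      by auto
  qed (use le in auto)
  have "emeasure M (\<Union>n. bad n) \<le> (\<Sum>n. emeasure M (bad n))"
    by (rule emeasure_subadditive_countably) auto
  also have "\<dots> \<le> (\<Sum>n. ennreal (d n))"
    by (intro suminf_le bad_le) auto
  also have "\<dots> = ennreal (suminf d)"
    using d by (intro suminf_ennreal2) auto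
  finally have "measure M (\<Union>n. bad n) \<le> suminf d"
    unfolding measure_def by (intro enn2real_leI) (use d in \<open>auto intro: suminf_nonneg\<close>)
  then have pos: "measure M (space M - (\<Union>n. bad n)) > 0"
    using d(3) by (subst prob_compl) auto
  have "outputs \<omega> \<in> G t" if \<omega>: "\<omega> \<in> space M - (\<Union>n. bad n)" for \<omega> t
  proof (induction t rule: less_induct)
    case (less t)
    have agree: "history (Suc t) \<omega> \<in> G i \<longleftrightarrow> outputs \<omega> \<in> G i" if "i \<le> t" for i
      by (rule G_cong) (use that in \<open>auto simp: history_eq_outputs\<close>)
    show ?case
    proof (rule ccontr)
      assume "outputs \<omega> \<notin> G t"
      then have "\<omega> \<in> bad t"
        using \<omega> less agree by (auto simp: bad_def)
      then show False using \<omega> by blast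
    qed
  qed
  then show ?thesis using pos by (intro bexI[of _ "space M - (\<Union>n. bad n)"]) auto
qed

end

section \<open>Growth of the precision\<close>

text \<open>A deterministic induction carrying two facts: the Euler ratio drives the recursion, and
  the size keeps the argument of \<open>growth_gap\<close> in the range where \<open>gap\<close>
  applies.\<close>

lemma (in gaussian_control_loop) precision_growth:
  fixes T :: nat and g :: "nat \<Rightarrow> real"
  assumes h: "mono_on {0..} h" and T: "T \<ge> 1" and g: "\<And>s. g s \<ge> 0"
    and gap: "\<And>s x. s \<ge> 1 \<Longrightarrow> x \<ge> exp (2 ^ s) \<Longrightarrow>
      ennreal (x powr (- 1 / (16 * (real s)\<^sup>2))) * growth_gap h x \<le> ennreal (g s)"
    and init: "2 ^ (T + 2) + 3 * \<bar>ln (1 / P\<^sub>0)\<bar> \<le> ln (1 / P\<^sub>0 + (f c)\<^sup>2)"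
    and p0: "p 0 = c"
    and good: "\<And>t. t < n \<Longrightarrow> (g (t + T + 1) + 1 / (real (t + T + 1))\<^sup>2) * spread t p \<le> \<bar>p (Suc t)\<bar> \<and>
        h \<bar>p (Suc t)\<bar> \<le> \<bar>f (p (Suc t))\<bar>"
  shows "(2 * real (n + T) + 1) * ln (precision n p) \<le> real (n + T) * ln (precision (Suc n) p) \<and>
      2 ^ (n + T + 2) \<le> ln (precision (Suc n) p)"
  using good
proof (induction n)
  case 0
  \<comment> \<open>Since \<open>T \<ge> 1\<close>, the factor \<open>2 * T + 1\<close> is at most
    \<open>3 * T\<close>; this is the 3 in \<open>init\<close>.\<close>
  have "(2 * real T + 1) * ln (1 / P\<^sub>0) \<le> (2 * real T + 1) * \<bar>ln (1 / P\<^sub>0)\<bar>"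
    by (intro mult_left_mono) auto
  also have "\<dots> \<le> (3 * real T) * \<bar>ln (1 / P\<^sub>0)\<bar>"
    using T by (intro mult_right_mono) auto
  also have "\<dots> = real T * (3 * \<bar>ln (1 / P\<^sub>0)\<bar>)" by simp
  also have "\<dots> \<le> real T * ln (1 / P\<^sub>0 + (f c)\<^sup>2)"
    by (intro mult_left_mono order_trans[OF _ init]) auto
  finally have "(2 * real T + 1) * ln (1 / P\<^sub>0) \<le> real T * ln (1 / P\<^sub>0 + (f c)\<^sup>2)" .
  moreover have "2 ^ (T + 2) \<le> ln (1 / P\<^sub>0 + (f c)\<^sup>2)"
    using init by linarith
  ultimately show ?case by (simp add: precision_def p0)
next
  case (Suc n)
  define a\<^sub>0 where "a\<^sub>0 = ln (precision n p)"
  define a\<^sub>1 where "a\<^sub>1 = ln (precision (Suc n) p)"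
  define a\<^sub>2 where "a\<^sub>2 = ln (precision (Suc (Suc n)) p)"
  define \<tau> where "\<tau> = real (n + T)"
  define s where "s = \<tau> + 1"
  define d where "d = a\<^sub>1 - a\<^sub>0"
  have \<tau>: "\<tau> \<ge> 1" using T by (simp add: \<tau>_def)
  have ratio: "(2 * \<tau> + 1) * a\<^sub>0 \<le> \<tau> * a\<^sub>1" and a1: "2 ^ (n + T + 2) \<le> a\<^sub>1"
    using Suc.IH Suc.prems by (simp_all add: a\<^sub>0_def a\<^sub>1_def \<tau>_def)
  have a1_pos: "a\<^sub>1 > 0"
    by (rule less_le_trans[OF _ a1]) simp
  \<comment> \<open>Valid for negative \<open>a\<^sub>0\<close> too; at least half of
    \<open>a\<^sub>1\<close> stems from the last increment.\<close>
  have "(2 * \<tau> + 1) * (2 * a\<^sub>0) \<le> (2 * \<tau> + 1) * a\<^sub>1"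
    using ratio a1_pos by (simp add: algebra_simps)
  then have "2 * a\<^sub>0 \<le> a\<^sub>1" using \<tau> by simp
  then have d: "d \<ge> 2 ^ (n + T + 1)"
    using a1 by (simp add: d_def)
  \<comment> \<open>Half the constant of the Euler step; squaring \<open>f\<close> below restores
    the factor 2. As \<open>q \<ge> 1\<close>, the point \<open>exp (q * d)\<close> lies in the
    range of \<open>gap\<close> at index \<open>n + T + 1\<close>.\<close>
  define q where "q = 8 * s\<^sup>2 / (4 * s\<^sup>2 + 1)"
  have s: "s \<ge> 1" using \<tau> by (simp add: s_def)
  then have "1 \<le> s\<^sup>2" by simp
  then have "4 * s\<^sup>2 + 1 > 0" "4 * s\<^sup>2 + 1 \<le> 8 * s\<^sup>2" by linarith+
  then have "1 \<le> q" unfolding q_def by (simp add: pos_le_divide_eq)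
  then have qd: "2 ^ (n + T + 1) \<le> q * d"
    using d mult_mono[of 1 q "2 ^ (n + T + 1)" d] by simp
  have spread: "spread n p = exp (d / 2)"
  proof -
    have "precision (Suc n) p / precision n p = exp d"
      by (simp add: d_def a\<^sub>0_def a\<^sub>1_def exp_diff precision_pos)
    also have "\<dots> = (exp (d / 2))\<^sup>2" by (simp add: exp_double[symmetric])
    finally show ?thesis by (simp add: spread_def)
  qed
  have s_eq: "s = real (n + T + 1)" by (simp add: s_def \<tau>_def)
  \<comment> \<open>The summand \<open>1 / s^2\<close> yields the strict inequality needed to pass
    below the generalized inverse.\<close>
  have "g (n + T + 1) * exp (d / 2) < (g (n + T + 1) + 1 / s\<^sup>2) * exp (d / 2)"
    using s by (intro mult_strict_right_mono) auto
  also have "\<dots> \<le> \<bar>p (Suc n)\<bar>"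
    using Suc.prems[of n] by (simp add: spread s_eq)
  finally have jump: "g (n + T + 1) * exp (d / 2) < \<bar>p (Suc n)\<bar>" .
  have "exp (q * d) \<le> h \<bar>p (Suc n)\<bar>"
  proof (rule le_of_growth_gap_le[OF h _ g _ _ jump])
    show "exp (q * d) = exp (8 * s\<^sup>2 / (4 * s\<^sup>2 + 1) * d)" by (simp add: q_def)
    show "ennreal (exp (q * d) powr (- 1 / (16 * s\<^sup>2))) * growth_gap h (exp (q * d)) \<le> ennreal (g (n + T + 1))"
      unfolding s_eq by (rule gap) (use qd in auto)
  qed (use s in auto)
  also have "\<dots> \<le> \<bar>f (p (Suc n))\<bar>" using Suc.prems[of n] by simp
  finally have "(exp (q * d))\<^sup>2 \<le> (f (p (Suc n)))\<^sup>2"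
    by (metis abs_ge_zero power2_abs power_mono exp_ge_zero)
  then have "exp (2 * (q * d)) \<le> precision (Suc (Suc n)) p"
    using precision_pos[of "Suc n" p] by (simp add: exp_double precision_Suc[of "Suc n"])
  then have "2 * (q * d) \<le> a\<^sub>2"
    unfolding a\<^sub>2_def by (simp add: ln_ge_iff precision_pos)
  then have "16 * s\<^sup>2 / (4 * s\<^sup>2 + 1) * (a\<^sub>1 - a\<^sub>0) \<le> a\<^sub>2"
    by (simp add: q_def d_def)
  then have step: "(2 * (\<tau> + 1) + 1) * a\<^sub>1 \<le> (\<tau> + 1) * a\<^sub>2"
    by (intro discrete_euler_step[OF _ _ ratio]) (use \<tau> a1_pos in \<open>auto simp: s_def\<close>)
  then have "(\<tau> + 1) * (2 * a\<^sub>1) \<le> (\<tau> + 1) * a\<^sub>2"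
    using a1_pos by (simp add: algebra_simps)
  then have "2 * a\<^sub>1 \<le> a\<^sub>2" using \<tau> by simp
  then have "2 ^ (Suc n + T + 2) \<le> a\<^sub>2" using a1 by simp
  with step show ?case
    by (simp add: a\<^sub>1_def a\<^sub>2_def \<tau>_def add_ac)
qed

text \<open>The last increment is at least half of the log precision, and \<open>spread\<close> is
  the exponential of half that increment.\<close>

lemma (in gaussian_control_loop) spread_ge:
  assumes ratio: "(2 * real (n + T) + 1) * ln (precision n p) \<le> real (n + T) * ln (precision (Suc n) p)"
    and large: "2 ^ (n + T + 2) \<le> ln (precision (Suc n) p)"
  shows "exp (2 ^ (n + T)) \<le> spread n p"
proof -
  define a\<^sub>0 where "a\<^sub>0 = ln (precision n p)"
  define a\<^sub>1 where "a\<^sub>1 = ln (precision (Suc n) p)"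
  have "a\<^sub>1 > 0"
    unfolding a\<^sub>1_def by (rule less_le_trans[OF _ large]) simp
  then have "(2 * real (n + T) + 1) * (2 * a\<^sub>0) \<le> (2 * real (n + T) + 1) * a\<^sub>1"
    using ratio unfolding a\<^sub>0_def[symmetric] a\<^sub>1_def[symmetric] by (simp add: algebra_simps)
  then have "2 * a\<^sub>0 \<le> a\<^sub>1" by simp
  then have "2 * 2 ^ (n + T) \<le> a\<^sub>1 - a\<^sub>0"
    using large by (simp add: a\<^sub>1_def[symmetric])
  then have "exp (2 * 2 ^ (n + T)) \<le> exp (a\<^sub>1 - a\<^sub>0)" by simp
  also have "\<dots> = precision (Suc n) p / precision n p"
    by (simp add: a\<^sub>0_def a\<^sub>1_def exp_diff precision_pos)
  finally have "(exp (2 ^ (n + T)))\<^sup>2 \<le> precision (Suc n) p / precision n p"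
    by (simp only: exp_double)
  then show ?thesis unfolding spread_def by (rule real_le_rsqrt)
qed

text \<open>Failure means landing near zero or in the thin set. A doubly exponential
  \<open>\<sigma>\<close> makes the iterated logarithm linear in \<open>k\<close>, so the thin set
  costs a summable power of \<open>k\<close>.\<close>

lemma (in gaussian_control_loop) one_step_failure_le:
  fixes \<epsilon> :: real
  assumes S: "S \<in> sets borel" and \<epsilon>: "\<epsilon> \<ge> 0" and K: "K \<ge> 0" and \<delta>: "\<delta> > 0"
    and thin: "\<And>l x. l \<ge> l\<^sub>0 \<Longrightarrow> l > 0 \<Longrightarrow> measure lborel (S \<inter> {x - l..x + l}) \<le> K / ln (ln l) powr (1 + \<delta>) * l"
    and \<sigma>: "exp (2 ^ k) \<le> \<sigma>" and k: "k \<ge> 1" "l\<^sub>0 \<le> exp (2 ^ k)"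
  shows "(\<integral>\<^sup>+v. ennreal (normal_density m \<sigma> v) * indicator ({v. \<bar>v\<bar> < \<epsilon> * \<sigma>} \<union> S) v \<partial>lborel)
      \<le> ennreal (\<epsilon> + 4 * (K / (real k * ln 2) powr (1 + \<delta>)))"
proof -
  let ?\<kappa> = "K / (real k * ln 2) powr (1 + \<delta>)"
  note [measurable] = S
  have pos: "\<sigma> > 0" by (rule less_le_trans[OF _ \<sigma>]) simp
  have "(\<integral>\<^sup>+v. ennreal (normal_density m \<sigma> v) * indicator ({v. \<bar>v\<bar> < \<epsilon> * \<sigma>} \<union> S) v \<partial>lborel) \<le>
    (\<integral>\<^sup>+v. ennreal (normal_density m \<sigma> v) * indicator {v. \<bar>v\<bar> < \<epsilon> * \<sigma>} v +
        ennreal (normal_density m \<sigma> v) * indicator S v \<partial>lborel)"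
    by (intro nn_integral_mono) (auto simp: indicator_def)
  also have "\<dots> = (\<integral>\<^sup>+v. ennreal (normal_density m \<sigma> v) * indicator {v. \<bar>v\<bar> < \<epsilon> * \<sigma>} v \<partial>lborel) +
        (\<integral>\<^sup>+v. ennreal (normal_density m \<sigma> v) * indicator S v \<partial>lborel)"
    by (rule nn_integral_add) measurable
  also have "\<dots> \<le> ennreal \<epsilon> + ennreal (4 * ?\<kappa>)"
  proof (intro add_mono nn_integral_normal_density_near_zero_le nn_integral_normal_density_le)
    fix l assume l: "\<sigma> \<le> l"
    have "exp (2 ^ k) \<le> l" "l > 0" using l \<sigma> pos by auto
    then have "2 ^ k \<le> ln l" by (simp add: ln_ge_iff)
    then have "ln (2 ^ k) \<le> ln (ln l)"
      by (subst ln_le_cancel_iff) (auto intro: less_le_trans[of 0 "2 ^ k"])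
    then have "real k * ln 2 \<le> ln (ln l)" by (simp add: ln_realpow)
    then have "(real k * ln 2) powr (1 + \<delta>) \<le> ln (ln l) powr (1 + \<delta>)"
      using \<delta> k by (intro powr_mono2) auto
    then have "K / ln (ln l) powr (1 + \<delta>) \<le> ?\<kappa>"
      using K k by (intro divide_left_mono) (auto intro!: mult_pos_pos)
    then have "K / ln (ln l) powr (1 + \<delta>) * l \<le> ?\<kappa> * l"
      using \<open>l > 0\<close> by (intro mult_right_mono) auto
    then show "measure lborel (S \<inter> {m - l..m + l}) \<le> ?\<kappa> * l"
      using thin[of l m] \<open>exp (2 ^ k) \<le> l\<close> \<open>l > 0\<close> k by linarith
  qed (use pos \<epsilon> K S in auto)
  also have "\<dots> = ennreal (\<epsilon> + 4 * ?\<kappa>)"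
    using \<epsilon> K by (subst ennreal_plus[symmetric]) auto
  finally show ?thesis .
qed

lemma (in gaussian_control_loop) sets_spread_le:
  assumes [measurable]: "S \<in> sets borel"
  shows "{p. \<epsilon> * spread t p \<le> \<bar>p (Suc t)\<bar> \<and> p (Suc t) \<notin> S} \<in> sets sequence_space"
proof -
  have "{p \<in> space sequence_space. \<epsilon> * spread t p \<le> \<bar>p (Suc t)\<bar>} \<in> sets sequence_space"
    by (rule borel_measurable_le) measurable
  moreover have "{p \<in> space sequence_space. p (Suc t) \<notin> S} \<in> sets sequence_space"
    by measurable
  ultimately have "{p \<in> space sequence_space. \<epsilon> * spread t p \<le> \<bar>p (Suc t)\<bar>} \<inter>
      {p \<in> space sequence_space. p (Suc t) \<notin> S} \<in> sets sequence_space"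
    by (rule sets.Int)
  then show ?thesis by (simp add: space_PiM Collect_conj_eq)
qed

section \<open>Choice of thresholds, time shift and initial value, and divergence on the good
  event\<close>

theorem theorem2p6:
  fixes M :: "'a measure" and \<theta> :: "'a \<Rightarrow> real" and w :: "nat \<Rightarrow> 'a \<Rightarrow> real"
    and f h :: "real \<Rightarrow> real" and \<theta>\<^sub>0 P\<^sub>0 \<delta> :: real
  assumes "prob_space M"
    and "piecewise_continuous_on UNIV f"
    and "prob_space.indep_vars M (\<lambda>_. borel) w {1..}"
    and "\<And>t. t \<ge> 1 \<Longrightarrow> distributed M lborel (w t) std_normal_density"
    and "P\<^sub>0 > 0"
    and "distributed M lborel \<theta> (normal_density \<theta>\<^sub>0 (sqrt P\<^sub>0))"
    and "indep_variables M borel \<theta> noise_space (noise w)"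
    and "\<And>x. x \<ge> 0 \<Longrightarrow> h x \<ge> 0"
    and "mono_on {0..} h"
    and "piecewise_continuous_on {0..} h"
    and "\<exists>C\<^sub>1 C\<^sub>2. \<forall>x\<ge>0. h x \<le> C\<^sub>1 * x ^ 4 + C\<^sub>2"
    and "(\<Sum>\<^sub>\<infinity>t\<in>{1::nat..}. SUP x\<in>{exp (2 ^ t)..}.
            ennreal (x powr (- 1 / (16 * (real t)\<^sup>2))) * growth_gap h x) < \<infinity>"
    and "\<delta> > 0"
    and "(\<lambda>l::real. SUP x::real. measure lebesgue ({x. \<bar>f x\<bar> < h \<bar>x\<bar>} \<inter> {x - l..x + l}) / l)
           \<in> O[at_top](\<lambda>l. 1 / ln (ln l) powr (1 + \<delta>))"
  shows "unstabilizable M f \<theta> w"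
  unfolding unstabilizable_def
proof (intro allI impI)
  fix u assume u: "feedback_law u"
  interpret M: prob_space M by fact
  define S where "S = {x. \<bar>f x\<bar> < h \<bar>x\<bar>}"
  have [measurable]: "f \<in> borel_measurable borel"
    using assms(2) by (rule piecewise_continuous_measurable)
  have [measurable]: "(\<lambda>x. h \<bar>x\<bar>) \<in> borel_measurable borel"
    using assms(9) by (rule mono_on_half_line_measurable)
  have S[measurable]: "S \<in> sets borel"
    unfolding S_def by measurable
  obtain K l\<^sub>0 where K: "K > 0" and thin:
    "\<And>l x. l \<ge> l\<^sub>0 \<Longrightarrow> l > 0 \<Longrightarrow> measure lborel (S \<inter> {x - l..x + l}) \<le> K / ln (ln l) powr (1 + \<delta>) * l"
    using thin_set_bound[OF S assms(14)[folded S_def]] by metis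
  let ?g = "\<lambda>t. SUP x\<in>{exp (2 ^ t)..}. ennreal (x powr (- 1 / (16 * (real t)\<^sup>2))) * growth_gap h x"
  define g where "g t = enn2real (?g t)" for t
  have g_nonneg: "g t \<ge> 0" for t by (simp add: g_def)
  have gap: "ennreal (x powr (- 1 / (16 * (real s)\<^sup>2))) * growth_gap h x \<le> ennreal (g s)"
    if "s \<ge> 1" "x \<ge> exp (2 ^ s)" for s x
  proof -
    have "ennreal (x powr (- 1 / (16 * (real s)\<^sup>2))) * growth_gap h x \<le> ?g s"
      using that by (intro SUP_upper) auto
    also have "\<dots> = ennreal (g s)"
      unfolding g_def by (rule summable_enn2real(1)[OF assms(12) that(1)])
    finally show ?thesis .
  qed
  \<comment> \<open>The required size of the next output relative to \<open>spread\<close>: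
    \<open>g\<close> serves the growth of \<open>h\<close>, and the summable square gives strictness
    and a positive lower bound even where \<open>g\<close> vanishes.\<close>
  define \<epsilon> where "\<epsilon> k = g (k + 1) + 1 / (real (k + 1))\<^sup>2" for k
  \<comment> \<open>The one-step failure bound. At \<open>k = 0\<close> its second term is 0 by
    division by zero, but only indices \<open>k \<ge> T \<ge> 1\<close> are used as
    probabilities.\<close>
  define \<beta> where "\<beta> k = \<epsilon> k + 4 * (K / (real k * ln 2) powr (1 + \<delta>))" for k
  have \<epsilon>_nonneg: "\<epsilon> k \<ge> 0" for k by (simp add: \<epsilon>_def g_nonneg)
  have \<beta>_nonneg: "\<beta> k \<ge> 0" for k using K by (simp add: \<beta>_def \<epsilon>_nonneg)
  have summable: "summable \<beta>"
  proof -
    have "summable (\<lambda>k. g (Suc k))"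
      unfolding g_def by (rule summable_enn2real(2)[OF assms(12)])
    moreover have "summable (\<lambda>k. 1 / (real (Suc k))\<^sup>2)"
      using inverse_power_summable[of 2, where 'a = real]
      by (subst summable_Suc_iff) (simp add: inverse_eq_divide)
    moreover have "summable (\<lambda>k. 4 * K / ln 2 powr (1 + \<delta>) * real k powr - (1 + \<delta>))"
      using assms(13) by (intro summable_mult) (simp add: summable_real_powr_iff)
    ultimately have "summable (\<lambda>k. g (Suc k) + 1 / (real (Suc k))\<^sup>2 +
        4 * K / ln 2 powr (1 + \<delta>) * real k powr - (1 + \<delta>))"
      by (intro summable_add)
    also have "(\<lambda>k. g (Suc k) + 1 / (real (Suc k))\<^sup>2 +
        4 * K / ln 2 powr (1 + \<delta>) * real k powr - (1 + \<delta>)) = \<beta>"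
    proof
      fix k
      have "4 * (K / (real k * ln 2) powr (1 + \<delta>)) = 4 * K / ln 2 powr (1 + \<delta>) * real k powr - (1 + \<delta>)"
        by (simp add: powr_mult powr_minus field_simps del: minus_add_distrib)
      then show "g (Suc k) + 1 / (real (Suc k))\<^sup>2 +
          4 * K / ln 2 powr (1 + \<delta>) * real k powr - (1 + \<delta>) = \<beta> k"
        by (simp add: \<beta>_def \<epsilon>_def)
    qed
    finally show ?thesis .
  qed
  obtain N where N: "\<And>n. n \<ge> N \<Longrightarrow> norm (\<Sum>i. \<beta> (i + n)) < 1"
    using suminf_exist_split[OF _ summable, of 1] by auto
  \<comment> \<open>The time shift: beyond \<open>N\<close> the failure bounds sum to less than one,
    and beyond \<open>l\<^sub>0\<close> the window scale \<open>exp (2 ^ k)\<close> is within reach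
    of \<open>thin\<close>.\<close>
  define T where "T = max (max 1 N) (nat \<lceil>l\<^sub>0\<rceil>)"
  have T: "T \<ge> 1" "T \<ge> N" "l\<^sub>0 \<le> real T"
    unfolding T_def by (auto simp: le_max_iff_disj) linarith
  have l0_le: "l\<^sub>0 \<le> exp (2 ^ k)" if "k \<ge> T" for k
  proof -
    have "real k < 2 ^ k" by (rule of_nat_less_two_power)
    also have "\<dots> < exp (2 ^ k)" using exp_ge_add_one_self[of "2 ^ k :: real"] by linarith
    finally show ?thesis using T(3) that by linarith
  qed
  obtain c where c_notin: "c \<notin> S"
    and c_init: "2 ^ (T + 2) + 3 * \<bar>ln (1 / P\<^sub>0)\<bar> \<le> ln (1 / P\<^sub>0 + (f c)\<^sup>2)"
  proof -
    define W where "W = 2 ^ (T + 2) + 3 * \<bar>ln (1 / P\<^sub>0)\<bar>"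
    \<comment> \<open>The exponent 2^1 admits \<open>gap\<close> at index 1; \<open>W\<close> is the
      initial log precision demanded by \<open>precision_growth\<close>.\<close>
    define z where "z = exp (max (2 ^ 1) W)"
    have "\<exists>x\<ge>0. z \<le> h x"
      by (rule exists_large_value[OF gap[of 1]]) (simp_all add: z_def)
    then obtain x where x: "x \<ge> 0" "z \<le> h x" by blast
    \<comment> \<open>Beyond \<open>x\<close> monotonicity keeps \<open>h\<close> above
      \<open>z\<close>, and outside \<open>S\<close> the value of \<open>f\<close> is at least that
      large.\<close>
    obtain c where c: "c \<ge> x" "c \<notin> S"
      using exists_point_outside_thin_set[OF assms(13) S thin] by blast
    have "z \<le> h c" using mono_onD[OF assms(9), of x c] x c by auto
    also have "\<dots> \<le> \<bar>f c\<bar>" using c x by (simp add: S_def)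
    finally have fc: "z \<le> \<bar>f c\<bar>" .
    have "1 \<le> z" by (simp add: z_def)
    have "exp W \<le> z" by (simp add: z_def)
    also have "\<dots> \<le> \<bar>f c\<bar>" by (rule fc)
    also have "\<dots> \<le> \<bar>f c\<bar>\<^sup>2" using fc \<open>1 \<le> z\<close> by (intro self_le_power) auto
    also have "\<dots> \<le> 1 / P\<^sub>0 + (f c)\<^sup>2" using assms(5) by simp
    finally have "W \<le> ln (1 / P\<^sub>0 + (f c)\<^sup>2)"
      using assms(5) by (subst ln_ge_iff) (auto intro: add_pos_nonneg)
    then show thesis using that c by (simp add: W_def)
  qed
  interpret L: gaussian_control_loop M f \<theta> w u \<theta>\<^sub>0 P\<^sub>0 c
    by unfold_locales (use assms(3-7) u in auto)
  define G where "G t = {p. \<epsilon> (t + T) * L.spread t p \<le> \<bar>p (Suc t)\<bar> \<and> p (Suc t) \<notin> S}" for t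
  \<comment> \<open>Stated for arbitrary sequences, to apply both to zero-padded histories and to
    the realized outputs.\<close>
  have spread_large: "exp (2 ^ (n + T)) \<le> L.spread n p"
    if "p 0 = c" "\<And>t. t < n \<Longrightarrow> p \<in> G t" for n p
  proof -
    have "(g (t + T + 1) + 1 / (real (t + T + 1))\<^sup>2) * L.spread t p \<le> \<bar>p (Suc t)\<bar> \<and>
        h \<bar>p (Suc t)\<bar> \<le> \<bar>f (p (Suc t))\<bar>" if "t < n" for t
      using \<open>\<And>t. t < n \<Longrightarrow> p \<in> G t\<close>[OF that] by (auto simp: G_def \<epsilon>_def S_def)
    from L.precision_growth[OF assms(9) T(1) g_nonneg gap c_init that(1) this]
    show ?thesis by (intro L.spread_ge) auto
  qed
  have "\<exists>D\<in>sets M. measure M D > 0 \<and> (\<forall>\<omega>\<in>D. \<forall>t. L.outputs \<omega> \<in> G t)"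
  proof (rule L.exists_event_all_good)
    fix t
    show "G t \<in> sets sequence_space"
      unfolding G_def by (rule L.sets_spread_le[OF S])
  next
    fix t and p q :: "nat \<Rightarrow> real"
    assume "\<And>i. i \<le> Suc t \<Longrightarrow> p i = q i"
    then show "p \<in> G t \<longleftrightarrow> q \<in> G t"
      using L.spread_cong[of t p q] by (simp add: G_def)
  next
    fix n \<omega> m
    assume past: "\<And>t. t < n \<Longrightarrow> L.history n \<omega> \<in> G t"
    let ?p = "L.history n \<omega>"
    have "?p 0 = c" by (simp add: L.history_eq_outputs L.outputs_0)
    then have large: "exp (2 ^ (n + T)) \<le> L.spread n ?p"
      using past by (rule spread_large)
    \<comment> \<open>\<open>spread n\<close> does not see the new entry, so failure is a condition
      on \<open>v\<close> alone.\<close>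
    have "?p(Suc n := v) \<in> - G n \<longleftrightarrow> v \<in> {v. \<bar>v\<bar> < \<epsilon> (n + T) * L.spread n ?p} \<union> S" for v
      using L.spread_cong[of n "?p(Suc n := v)" ?p] by (auto simp: G_def)
    then have "(\<integral>\<^sup>+v. ennreal (normal_density m (L.spread n ?p) v) * indicator (- G n) (?p(Suc n := v)) \<partial>lborel) =
      (\<integral>\<^sup>+v. ennreal (normal_density m (L.spread n ?p) v) *
          indicator ({v. \<bar>v\<bar> < \<epsilon> (n + T) * L.spread n ?p} \<union> S) v \<partial>lborel)"
      by (simp only: indicator_def of_bool_def)
    also have "\<dots> \<le> ennreal (\<beta> (n + T))"
      unfolding \<beta>_def
      by (rule L.one_step_failure_le[OF S _ _ assms(13) thin large])
        (use \<epsilon>_nonneg K T l0_le[of "n + T"] in auto)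
    finally show "(\<integral>\<^sup>+v. ennreal (normal_density m (L.spread n ?p) v) * indicator (- G n) (?p(Suc n := v)) \<partial>lborel)
        \<le> ennreal (\<beta> (n + T))" .
  next
    show "summable (\<lambda>n. \<beta> (n + T))" using summable by (rule summable_ignore_initial_segment)
    show "(\<Sum>n. \<beta> (n + T)) < 1" using N[OF T(2)] by simp
  qed (rule \<beta>_nonneg)
  then obtain D where D: "D \<in> sets M" "measure M D > 0"
    and good: "\<And>\<omega> t. \<omega> \<in> D \<Longrightarrow> L.outputs \<omega> \<in> G t"
    by blast
  have "limsup (\<lambda>t. ereal (1 / real t * (\<Sum>i=1..t. (L.outputs \<omega> i)\<^sup>2))) = \<infinity>" if \<omega>: "\<omega> \<in> D" for \<omega>
  proof (rule limsup_eq_infinity_of_ge)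
    fix t
    \<comment> \<open>A doubly exponential lower bound for the next output; its polynomial loss
      cannot prevent divergence of the averages.\<close>
    have "1 / (real (t + T + 1))\<^sup>2 * exp (2 ^ (t + T)) \<le> \<epsilon> (t + T) * L.spread t (L.outputs \<omega>)"
      by (intro mult_mono spread_large)
        (use good[OF \<omega>] g_nonneg \<epsilon>_nonneg in \<open>auto simp: L.outputs_0 \<epsilon>_def\<close>)
    also have "\<dots> \<le> \<bar>L.outputs \<omega> (Suc t)\<bar>"
      using good[OF \<omega>, of t] by (simp add: G_def)
    finally show "(1 / (real (t + T + 1))\<^sup>2 * exp (2 ^ (t + T)))\<^sup>2 \<le> (L.outputs \<omega> (Suc t))\<^sup>2"
      by (metis abs_ge_zero power2_abs power_mono mult_nonneg_nonneg exp_ge_zero zero_le_divide_1_iff zero_le_power2)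
  next
    show "filterlim (\<lambda>t. (1 / (real (t + T + 1))\<^sup>2 * exp (2 ^ (t + T)))\<^sup>2 / real (Suc t)) at_top sequentially"
      by real_asymp
  qed
  moreover have "initial_value M \<theta> w (\<lambda>_. c)"
    unfolding initial_value_def
  proof (rule M.indep_variables_const)
    have [measurable]: "noise w \<in> M \<rightarrow>\<^sub>M noise_space"
      using assms(7) by (simp add: indep_variables_def)
    show "(\<lambda>\<omega>. (\<theta> \<omega>, noise w \<omega>)) \<in> M \<rightarrow>\<^sub>M borel \<Otimes>\<^sub>M noise_space"
      by measurable
  qed
  moreover have "closed_loop M f \<theta> w u (\<lambda>t \<omega>. L.outputs \<omega> t)"
    unfolding closed_loop_def using L.outputs_Suc by simp
  ultimately show "\<exists>y. initial_value M \<theta> w (y 0) \<and> closed_loop M f \<theta> w u y \<and>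
         (\<exists>D\<in>sets M. measure M D > 0 \<and>
           (\<forall>\<omega>\<in>D. limsup (\<lambda>t. ereal (1 / real t * (\<Sum>i=1..t. (y i \<omega>)\<^sup>2))) = \<infinity>))"
    using D by (intro exI[of _ "\<lambda>t \<omega>. L.outputs \<omega> t"]) (auto simp: L.outputs_0)
qed

end
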